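(* Let $G$ have property $\mathcal{P}$ and let $\|\cdot\|_G$ be its Orlicz norm. Let $A\in\mathbb{R}^{n\times m}$ have rank $d\leq n$, and let $D\in\mathbb{R}^{n\times n}$ be a diagonal matrix each of whose diagonal entries is drawn from the distribution with cumulative distribution function $1-e^{-G(t)}$ ($t\ge0$). Then with probability at least $0.99$, $$\forall x\in\mathbb{R}^m,\quad \|D^{-1}Ax\|_G\leq O(\alpha_G d^2\log n)\,\|Ax\|_G,$$ where $\alpha_G\geq1$ is a constant which only depends on $G$.
   Context: A function $G:\mathbb{R}\to\mathbb{R}_+$ has property $\mathcal{P}$ if: (1) $G$ is a nonzero, monotone nondecreasing, convex function on $[0,\infty)$; (2) $G(0)=0$, $G(1)=1$, and $G(x)=G(-x)$ for all $x$; (3) there is $s>0$ such that $G(x)=sx+(1-s)$ for all $x>1$; (4) there is $\delta_G>0$ such that $G$ is twice differentiable on $(0,\delta_G)$, the right derivatives $G'_+(0)$ and $G''_+(0)$ exist (where $G''_+(x)=\lim_{h\to0^+}(G'(x+h)-G'_+(x))/h$), and either $G'_+(0)>0$ or $G''_+(0)>0$; (5) there is $C_G>0$ such that $G(y)/G(x)\leq C_G(y/x)^2$ for all $0<x<y$. The Orlicz norm is $\|x\|_G=\inf\{\alpha>0:\sum_{i=1}^n G(|x_i|/\alpha)\leq1\}$. $O(\cdot)$ hides absolute constants.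
   Formalization: The formal theorem assumes n ≥ 2: for n = 1 the factor log n is 0, and the inequality fails, for example, for A = [1] with d = 1. *)

theory Defs
  imports
    "HOL-Probability.Probability"
    "Jordan_Normal_Form.Matrix"
    "Jordan_Normal_Form.DL_Rank"
    "Jordan_Normal_Form.Gauss_Jordan_Elimination"
begin

text \<open>
  In the fourth clause, \<open>a\<close> is the right derivative of \<open>G\<close> at \<open>0\<close> and \<open>b\<close> the second one, i.e. the
  limit of \<open>(G'(0 + h) - a) / h\<close>.  This clause and convexity force \<open>G > 0\<close> on \<open>(0, \<infinity>)\<close>, so the
  quotient \<open>G y / G x\<close> in the last clause never has denominator \<open>0\<close>.
\<close>

definition property_P :: "(real \<Rightarrow> real) \<Rightarrow> bool" where
  "property_P G \<longleftrightarrow>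
     (\<forall>x. 0 \<le> G x) \<and>
     ((\<exists>x\<ge>0. G x \<noteq> 0) \<and> mono_on {0..} G \<and> convex_on {0..} G) \<and>
     (G 0 = 0 \<and> G 1 = 1 \<and> (\<forall>x. G x = G (- x))) \<and>
     (\<exists>s>0. \<forall>x>1. G x = s * x + (1 - s)) \<and>
     (\<exists>\<delta>>0. \<exists>a b.
        (\<forall>x. 0 < x \<and> x < \<delta> \<longrightarrow>
           G differentiable (at x) \<and> deriv G differentiable (at x)) \<and>
        (G has_real_derivative a) (at_right 0) \<and>
        ((\<lambda>h. (deriv G (0 + h) - a) / h) \<longlongrightarrow> b) (at_right 0) \<and>
        (a > 0 \<or> b > 0)) \<and>
     (\<exists>C>0. \<forall>x y. 0 < x \<and> x < y \<longrightarrow> G y / G x \<le> C * (y / x)\<^sup>2)"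

definition orlicz_norm :: "(real \<Rightarrow> real) \<Rightarrow> real Matrix.vec \<Rightarrow> real" where
  "orlicz_norm G x =
     Inf {\<alpha>. \<alpha> > 0 \<and> (\<Sum>i<dim_vec x. G (\<bar>vec_index x i\<bar> / \<alpha>)) \<le> 1}"

definition orlicz_cdf :: "(real \<Rightarrow> real) \<Rightarrow> real \<Rightarrow> real" where
  "orlicz_cdf G t = (if t \<ge> 0 then 1 - exp (- G t) else 0)"

text \<open>
  A random diagonal \<open>n \<times> n\<close> matrix is given by the joint law \<open>\<mu>\<close> of its diagonal, a probability
  measure on \<open>\<real>\<^sup>n\<close>; the matrix at the sample point \<open>\<omega>\<close> is \<open>mat_diag n \<omega>\<close>.  Only the marginals are
  prescribed, with no condition on the dependence between the entries: independent entries are the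
  case where \<open>\<mu>\<close> is the product measure.
\<close>

definition diagonal_law :: "(real \<Rightarrow> real) \<Rightarrow> nat \<Rightarrow> (nat \<Rightarrow> real) measure \<Rightarrow> bool" where
  "diagonal_law G n \<mu> \<longleftrightarrow>
     prob_space \<mu> \<and> sets \<mu> = sets (Pi\<^sub>M {..<n} (\<lambda>_. borel)) \<and>
     (\<forall>i<n. cdf (distr \<mu> borel (\<lambda>\<omega>. \<omega> i)) = orlicz_cdf G)"

text \<open>
  The library's \<open>mat_inverse\<close> returns \<open>None\<close> on singular matrices.  As \<open>orlicz_cdf G 0 = 0\<close>, a
  matrix drawn as above is almost surely invertible, so the unspecified value of \<open>mat_inv\<close> on
  singular matrices does not affect probabilities.
\<close>

definition mat_inv :: "real mat \<Rightarrow> real mat" where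
  "mat_inv D = the (mat_inverse D)"

end

theory Submission
  imports Defs
begin

text \<open>
  Regularity of \<open>G\<close> at \<open>0\<close> and at infinity makes it supermultiplicative up to a constant,
  \<open>G a * G b \<le> \<alpha> * G (a * b)\<close>, so \<open>G (y / w) \<le> \<alpha> * G y / G w\<close>.  Here \<open>G w\<close> is exponentially
  distributed when \<open>w\<close> is a diagonal entry, and \<open>1 / G w\<close>, truncated to the event that all \<open>n\<close> entries
  satisfy \<open>G w \<ge> 1 / O(n)\<close>, has expectation \<open>O(log n)\<close>.  The column space of \<open>A\<close> has vectors
  \<open>Y\<^sub>1, \<dots>, Y\<^sub>d\<close> in its unit ball such that every vector of the ball is a combination of them
  with coefficients in \<open>[-2, 2]\<close>.  Markov's inequality, applied once to the sum of \<open>G (Y\<^sub>j i) / G w\<^sub>i\<close>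
  over all \<open>i\<close> and \<open>j\<close>, bounds the dilation of these vectors, and convexity of \<open>G\<close> passes the bound
  to the whole column space.
\<close>

section \<open>Nearly Auerbach bases of column spaces\<close>

text \<open>A maximal independent set of columns spans all of them. It gives the column space
  injective coordinates, so that \<open>d\<close>-tuples in it become square matrices with
  determinants.\<close>

lemma rank_column_basis:
  fixes A :: "'a::field mat"
  assumes A: "A \<in> carrier_mat n m"
  obtains B where "B \<in> carrier_mat n (vec_space.rank n A)"
    and "\<And>c. c \<in> carrier_vec (vec_space.rank n A) \<Longrightarrow> B *\<^sub>v c = 0\<^sub>v n \<Longrightarrow> c = 0\<^sub>v (vec_space.rank n A)"
    and "(\<lambda>x. A *\<^sub>v x) ` carrier_vec m = (\<lambda>c. B *\<^sub>v c) ` carrier_vec (vec_space.rank n A)"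
proof -
  interpret vec_space "TYPE('a)" n .
  let ?C = "set (cols A)" and ?P = "\<lambda>T. T \<subseteq> set (cols A) \<and> lin_indpt T"
  have C: "?C \<subseteq> carrier_vec n"
    using A cols_dim by blast
  have "?P {}"
    by (auto simp: lin_dep_def)
  then obtain S where S: "finite S" "maximal S ?P"
    using maximal_exists_superset[of ?C ?P "{}"] by auto
  then have SC: "S \<subseteq> ?C" and indep: "lin_indpt S"
    by (auto simp: maximal_def)
  have card: "rank A = card S"
    using rank_card_indpt[OF A S(2)] .
  obtain vs where vs: "set vs = S" "distinct vs"
    using finite_distinct_list[OF S(1)] by blast
  have len: "length vs = rank A"
    using vs card distinct_card by fastforce
  define B where "B = mat_of_cols n vs"
  have cols_B: "cols B = vs"
    using vs SC C by (simp add: B_def)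
  have B: "B \<in> carrier_mat n (rank A)"
    using len by (auto simp: B_def)
  have inj: "c = 0\<^sub>v (rank A)" if "c \<in> carrier_vec (rank A)" "B *\<^sub>v c = 0\<^sub>v n" for c
    using lin_depI[OF B that(1) _ that(2)] indep vs cols_B by auto
  have "?C \<subseteq> span S"
  proof
    fix v assume v: "v \<in> ?C"
    have v_carrier: "v \<in> carrier_vec n" and S_carrier: "S \<subseteq> carrier_vec n"
      using v SC C by auto
    show "v \<in> span S"
    proof (rule ccontr)
      assume nin: "v \<notin> span S"
      then have "v \<notin> S"
        using span_mem[OF S_carrier] by blast
      moreover have "lin_indpt (S \<union> {v})"
        using lin_dep_iff_in_span[OF S_carrier indep v_carrier \<open>v \<notin> S\<close>] nin by blast
      ultimately show False
        using S(2) v SC \<open>v \<notin> S\<close> unfolding maximal_def by blast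
    qed
  qed
  then have "span ?C \<subseteq> span (span S)"
    by (rule span_is_monotone)
  then have "span ?C = span S"
    using span_is_monotone[OF SC] span_span[of S] SC C by (simp add: subset_antisym)
  then have "col_space A = col_space B"
    unfolding col_space_def cols_B vs .
  then have "(\<lambda>x. A *\<^sub>v x) ` carrier_vec m = (\<lambda>c. B *\<^sub>v c) ` carrier_vec (rank A)"
    using A B unfolding col_space_eq[OF A] col_space_eq[OF B] set_eq_iff image_iff mem_Collect_eq
    by (metis carrier_matD mult_mat_vec_carrier)
  then show thesis
    using that[OF B inj] by blast
qed

text \<open>By the Leibniz formula there are \<open>d!\<close> terms, each a product of
  \<open>d\<close> entries. The bound only has to make a set of determinants bounded above, so its
  crudeness costs nothing.\<close>

lemma abs_det_le:
  fixes M :: "real mat"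
  assumes M: "M \<in> carrier_mat d d" and le: "\<And>i j. i < d \<Longrightarrow> j < d \<Longrightarrow> \<bar>M $$ (i, j)\<bar> \<le> b"
  shows "\<bar>Determinant.det M\<bar> \<le> fact d * b ^ d"
proof -
  let ?S = "{p. p permutes {0..<d}}"
  have "\<bar>Determinant.det M\<bar> \<le> (\<Sum>p\<in>?S. \<bar>signof p * (\<Prod>i = 0..<d. M $$ (i, p i))\<bar>)"
    unfolding det_def'[OF M] by (rule sum_abs)
  also have "\<dots> \<le> (\<Sum>p\<in>?S. b ^ d)"
  proof (rule sum_mono)
    fix p assume "p \<in> ?S"
    then have p: "p i < d" if "i < d" for i
      using permutes_in_image[of p "{0..<d}" i] that by auto
    have "\<bar>signof p * (\<Prod>i = 0..<d. M $$ (i, p i))\<bar> = (\<Prod>i = 0..<d. \<bar>M $$ (i, p i)\<bar>)"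
      by (simp add: abs_mult abs_prod sign_def)
    also have "\<dots> \<le> (\<Prod>i = 0..<d. b)"
      using p by (intro prod_mono) (auto intro: le)
    finally show "\<bar>signof p * (\<Prod>i = 0..<d. M $$ (i, p i))\<bar> \<le> b ^ d"
      by simp
  qed
  also have "\<dots> = fact d * b ^ d"
    using card_permutations[of "{0..<d}" d] by simp
  finally show ?thesis .
qed

text \<open>For \<open>v\<close> in the kernel of the Gram matrix, \<open>B v\<close> is orthogonal
  to itself and so vanishes. As \<open>B\<close> need not be square, its Gram determinant is what
  turns bounds on \<open>B * U\<close> into bounds on the determinant of \<open>U\<close>.\<close>

lemma gram_det_nonzero:
  fixes B :: "real mat"
  assumes B: "B \<in> carrier_mat n d"
    and inj: "\<And>c. c \<in> carrier_vec d \<Longrightarrow> B *\<^sub>v c = 0\<^sub>v n \<Longrightarrow> c = 0\<^sub>v d"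
  shows "Determinant.det (B\<^sup>T * B) \<noteq> 0"
proof
  assume "Determinant.det (B\<^sup>T * B) = 0"
  moreover have BtB: "B\<^sup>T * B \<in> carrier_mat d d" and Bt: "B\<^sup>T \<in> carrier_mat d n"
    using B by auto
  ultimately obtain v where v: "v \<in> carrier_vec d" "v \<noteq> 0\<^sub>v d" "(B\<^sup>T * B) *\<^sub>v v = 0\<^sub>v d"
    using det_0_iff_vec_prod_zero_field by blast
  define w where "w = B *\<^sub>v v"
  have w: "w \<in> carrier_vec n"
    using B v by (simp add: w_def)
  have "B\<^sup>T *\<^sub>v w = 0\<^sub>v d"
    using assoc_mult_mat_vec[OF Bt B v(1)] v(3) by (simp add: w_def)
  then have "Matrix.scalar_prod w w = 0"
    using transpose_vec_mult_scalar[OF B v(1) w] v(1) by (simp add: w_def)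
  then have "vec_index w i = 0" if "i < n" for i
    using w that by (simp add: scalar_prod_def sum_nonneg_eq_0_iff)
  then have "w = 0\<^sub>v n"
    using w by auto
  then show False
    using inj v by (simp add: w_def)
qed

text \<open>
  An Auerbach basis maximizes the determinant over \<open>d\<close>-tuples in the ball.  Taking a tuple whose
  determinant exceeds half the supremum avoids any compactness argument and costs a factor \<open>2\<close> in
  the coefficients, which are quotients of determinants by Cramer's rule.
\<close>

lemma near_auerbach_basis:
  fixes A :: "real mat" and N :: "real Matrix.vec set"
  assumes A: "A \<in> carrier_mat n m" and d: "vec_space.rank n A = d"
    and bounded: "\<And>v i. v \<in> N \<Longrightarrow> i < n \<Longrightarrow> \<bar>vec_index v i\<bar> \<le> 1"
    and absorbing: "\<And>v. v \<in> carrier_vec n \<Longrightarrow> \<exists>c>0. c \<cdot>\<^sub>v v \<in> N"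
  shows "\<exists>Y. (\<forall>j<d. Y j \<in> N \<and> Y j \<in> (\<lambda>x. A *\<^sub>v x) ` carrier_vec m) \<and>
    (\<forall>v\<in>N \<inter> (\<lambda>x. A *\<^sub>v x) ` carrier_vec m.
       \<exists>x. (\<forall>j<d. \<bar>x j\<bar> \<le> 2) \<and> (\<forall>i<n. vec_index v i = (\<Sum>j<d. x j * vec_index (Y j) i)))"
proof -
  obtain B where B: "B \<in> carrier_mat n d"
    and inj: "\<And>c. c \<in> carrier_vec d \<Longrightarrow> B *\<^sub>v c = 0\<^sub>v n \<Longrightarrow> c = 0\<^sub>v d"
    and range: "(\<lambda>x. A *\<^sub>v x) ` carrier_vec m = (\<lambda>c. B *\<^sub>v c) ` carrier_vec d"
    using rank_column_basis[OF A] unfolding d by blast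
  define g where "g = \<bar>Determinant.det (B\<^sup>T * B)\<bar>"
  have g: "g > 0"
    using gram_det_nonzero[OF B inj] by (simp add: g_def)
  \<comment> \<open>If the columns of \<open>B * U\<close> belong to \<open>N\<close>, its entries
    are at most \<open>1\<close> in absolute value, so an entry of
    \<open>B\<^sup>T * (B * U)\<close> is at most an absolute column sum of \<open>B\<close>;
    \<open>b\<close> adds up all columns.\<close>
  define b where "b = (\<Sum>i<n. \<Sum>k<d. \<bar>B $$ (i, k)\<bar>)"
  \<comment> \<open>Coordinate matrices of \<open>d\<close>-tuples in \<open>N\<close>, one member
    of the tuple per column.\<close>
  define \<U> where "\<U> = {U \<in> carrier_mat d d. \<forall>j<d. B *\<^sub>v col U j \<in> N}"
  define X where "X = (\<lambda>U. \<bar>Determinant.det U\<bar>) ` \<U>"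
  have bdd: "bdd_above X"
  proof (rule bdd_aboveI)
    fix z assume "z \<in> X"
    then obtain U where U: "U \<in> carrier_mat d d" "\<And>j. j < d \<Longrightarrow> B *\<^sub>v col U j \<in> N"
      and z: "z = \<bar>Determinant.det U\<bar>"
      by (auto simp: X_def \<U>_def)
    have "\<bar>(B\<^sup>T * (B * U)) $$ (k, j)\<bar> \<le> b" if kj: "k < d" "j < d" for k j
    proof -
      have "(B\<^sup>T * (B * U)) $$ (k, j) = (\<Sum>i<n. B $$ (i, k) * vec_index (B *\<^sub>v col U j) i)"
        using B U kj by (auto simp: scalar_prod_def atLeast0LessThan intro!: sum.cong)
      also have "\<bar>\<dots>\<bar> \<le> (\<Sum>i<n. \<bar>B $$ (i, k) * vec_index (B *\<^sub>v col U j) i\<bar>)"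
        by (rule sum_abs)
      also have "\<dots> \<le> (\<Sum>i<n. \<bar>B $$ (i, k)\<bar>)"
      proof (rule sum_mono)
        fix i assume "i \<in> {..<n}"
        then have "\<bar>vec_index (B *\<^sub>v col U j) i\<bar> \<le> 1"
          using bounded U(2) kj by blast
        then show "\<bar>B $$ (i, k) * vec_index (B *\<^sub>v col U j) i\<bar> \<le> \<bar>B $$ (i, k)\<bar>"
          unfolding abs_mult by (rule mult_left_le) simp
      qed
      also have "\<dots> \<le> b"
        unfolding b_def using kj by (intro sum_mono member_le_sum) auto
      finally show ?thesis .
    qed
    then have "\<bar>Determinant.det (B\<^sup>T * (B * U))\<bar> \<le> fact d * b ^ d"
      using B U by (intro abs_det_le) auto
    also have "B\<^sup>T * (B * U) = (B\<^sup>T * B) * U"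
      using B U by (intro assoc_mult_mat[symmetric]) auto
    also have "\<bar>Determinant.det ((B\<^sup>T * B) * U)\<bar> = g * z"
      using B U by (subst det_mult[of _ d]) (auto simp: g_def z abs_mult)
    finally show "z \<le> fact d * b ^ d / g"
      using g by (simp add: field_simps)
  qed
  \<comment> \<open>Scaling each unit coordinate vector until its image lies in \<open>N\<close>
    gives a diagonal matrix with positive diagonal. Hence \<open>Sup X > 0\<close>, and some
    determinant exceeds \<open>Sup X / 2\<close>.\<close>
  have "\<exists>U\<in>\<U>. Determinant.det U \<noteq> 0"
  proof -
    have "\<exists>c>0. c \<cdot>\<^sub>v (B *\<^sub>v unit_vec d j) \<in> N" for j
      using absorbing B by simp
    then obtain c where c: "\<And>j. c j > 0" "\<And>j. c j \<cdot>\<^sub>v (B *\<^sub>v unit_vec d j) \<in> N"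
      by metis
    have "B *\<^sub>v col (mat_diag d c) j \<in> N" if j: "j < d" for j
    proof -
      have "col (mat_diag d c) j = c j \<cdot>\<^sub>v unit_vec d j"
        using j by (intro eq_vecI) (auto simp: mat_diag_def)
      then show ?thesis
        using c(2)[of j] B by (simp add: mult_mat_vec)
    qed
    moreover have "Determinant.det (mat_diag d c) = prod_list (diag_mat (mat_diag d c))"
      by (rule det_upper_triangular[of _ d]) (auto simp: mat_diag_def)
    moreover have "prod_list (diag_mat (mat_diag d c)) \<noteq> 0"
      using c(1) by (auto simp: diag_mat_def mat_diag_def) (metis less_irrefl)
    ultimately show ?thesis
      by (intro bexI[of _ "mat_diag d c"]) (auto simp: \<U>_def)
  qed
  then obtain U0 where U0: "U0 \<in> \<U>" "\<bar>Determinant.det U0\<bar> > 0"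
    by auto
  have "\<bar>Determinant.det U0\<bar> \<le> Sup X"
    using U0 bdd by (intro cSup_upper) (auto simp: X_def)
  then have "Sup X / 2 < Sup X" "0 < Sup X"
    using U0 by auto
  then obtain z where "z \<in> X" "Sup X / 2 < z"
    using less_cSupE[of "Sup X / 2" X] U0 by (auto simp: X_def)
  then obtain U where U: "U \<in> \<U>" "Sup X / 2 < \<bar>Determinant.det U\<bar>"
    by (auto simp: X_def)
  then have Uc: "U \<in> carrier_mat d d" and UN: "\<And>j. j < d \<Longrightarrow> B *\<^sub>v col U j \<in> N"
    by (auto simp: \<U>_def)
  have detU: "Determinant.det U \<noteq> 0"
    using U(2) \<open>0 < Sup X\<close> by auto
  show ?thesis
  proof (intro exI[of _ "\<lambda>j. B *\<^sub>v col U j"] conjI allI impI ballI)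
    fix j assume j: "j < d"
    show "B *\<^sub>v col U j \<in> N"
      using UN j .
    show "B *\<^sub>v col U j \<in> (\<lambda>x. A *\<^sub>v x) ` carrier_vec m"
      unfolding range using Uc j by auto
  next
    fix v assume v: "v \<in> N \<inter> (\<lambda>x. A *\<^sub>v x) ` carrier_vec m"
    then have vN: "v \<in> N"
      by simp
    obtain w where w: "w \<in> carrier_vec d" "v = B *\<^sub>v w"
      using v unfolding range by auto
    \<comment> \<open>The coordinates of \<open>v\<close> in the chosen tuple: the inverse of
      \<open>U\<close> applied to \<open>w\<close>, written with the adjugate.\<close>
    define x where "x = (1 / Determinant.det U) \<cdot>\<^sub>v (adj_mat U *\<^sub>v w)"
    have adj: "adj_mat U \<in> carrier_mat d d" "U * adj_mat U = Determinant.det U \<cdot>\<^sub>m 1\<^sub>m d"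
      using adj_mat[OF Uc] by auto
    have x: "x \<in> carrier_vec d"
      using adj w by (simp add: x_def)
    have Ux: "U *\<^sub>v x = w"
    proof -
      have "U *\<^sub>v x = (1 / Determinant.det U) \<cdot>\<^sub>v (U *\<^sub>v (adj_mat U *\<^sub>v w))"
        unfolding x_def using adj w Uc by (intro mult_mat_vec[of _ d d]) auto
      also have "U *\<^sub>v (adj_mat U *\<^sub>v w) = (Determinant.det U \<cdot>\<^sub>m 1\<^sub>m d) *\<^sub>v w"
        unfolding adj(2)[symmetric] using adj(1) w Uc by (intro assoc_mult_mat_vec[symmetric]) auto
      also have "\<dots> = Determinant.det U \<cdot>\<^sub>v w"
        using w by (intro eq_vecI) auto
      finally show ?thesis
        using detU by (simp add: smult_smult_assoc)
    qed
    have "\<bar>vec_index x j\<bar> \<le> 2" if j: "j < d" for j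
    proof -
      \<comment> \<open>Putting \<open>w\<close> into column \<open>j\<close> replaces one member of
        the tuple by \<open>v\<close>, which is itself in \<open>N\<close>. By Cramer's rule the new
        determinant is the \<open>j\<close>-th coordinate times the old one, and it is at most
        \<open>Sup X\<close>, which is below twice the old one.\<close>
      have "replace_col U w j \<in> \<U>"
      proof -
        have "col (replace_col U w j) k = (if k = j then w else col U k)" if "k < d" for k
          using that Uc w by (intro eq_vecI) (auto simp: replace_col_def)
        then show ?thesis
          using Uc UN vN w by (auto simp: \<U>_def replace_col_def)
      qed
      then have "\<bar>Determinant.det (replace_col U w j)\<bar> \<le> Sup X"
        using bdd by (intro cSup_upper) (auto simp: X_def)
      then have "\<bar>vec_index x j\<bar> * \<bar>Determinant.det U\<bar> \<le> 2 * \<bar>Determinant.det U\<bar>"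
        using cramer_lemma_mat[OF Uc x j] U(2) by (simp add: Ux abs_mult)
      then show ?thesis
        using detU by simp
    qed
    moreover have "vec_index v i = (\<Sum>j<d. vec_index x j * vec_index (B *\<^sub>v col U j) i)" if i: "i < n" for i
    proof -
      have "v = (B * U) *\<^sub>v x"
        using assoc_mult_mat_vec[OF B Uc x] by (simp add: w(2) Ux)
      then have "vec_index v i = (\<Sum>j<d. (B * U) $$ (i, j) * vec_index x j)"
        using i B Uc x by (simp add: scalar_prod_def atLeast0LessThan del: assoc_mult_mat_vec)
      also have "\<dots> = (\<Sum>j<d. vec_index x j * vec_index (B *\<^sub>v col U j) i)"
        using i B Uc by (intro sum.cong) auto
      finally show ?thesis .
    qed
    ultimately show "\<exists>x. (\<forall>j<d. \<bar>x j\<bar> \<le> 2) \<and>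
        (\<forall>i<n. vec_index v i = (\<Sum>j<d. x j * vec_index (B *\<^sub>v col U j) i))"
      by blast
  qed
qed

section \<open>Orlicz functions and norms\<close>

locale orlicz_function =
  fixes G :: "real \<Rightarrow> real"
  assumes property_P: "property_P G"
begin

section \<open>Consequences of evenness, monotonicity and convexity\<close>

lemma nonneg [simp]: "0 \<le> G x"
  using property_P by (simp add: property_P_def)

lemma zero [simp]: "G 0 = 0" and one [simp]: "G 1 = 1"
  using property_P by (simp_all add: property_P_def)

lemma even: "G (- x) = G x"
  using property_P unfolding property_P_def by metis

lemma abs [simp]: "G \<bar>x\<bar> = G x"
  by (simp add: abs_if even)

lemma mono: "\<bar>x\<bar> \<le> \<bar>y\<bar> \<Longrightarrow> G x \<le> G y"
proof -
  assume le: "\<bar>x\<bar> \<le> \<bar>y\<bar>"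
  have "mono_on {0..} G"
    using property_P by (simp add: property_P_def)
  then have "G \<bar>x\<bar> \<le> G \<bar>y\<bar>"
    using le by (intro mono_onD[of "{0..}" G]) auto
  then show ?thesis
    by simp
qed

lemma convex: "convex_on {0..} G"
  using property_P by (simp add: property_P_def)

text \<open>Convexity on the segment from \<open>0\<close> to \<open>\<bar>x\<bar>\<close>, where
  \<open>G 0 = 0\<close>; evenness removes the sign of \<open>x\<close>.\<close>

lemma contract: "G (t * x) \<le> t * G x" if "0 \<le> t" "t \<le> 1"
proof -
  have "G ((1 - t) *\<^sub>R 0 + t *\<^sub>R \<bar>x\<bar>) \<le> (1 - t) * G 0 + t * G \<bar>x\<bar>"
    using that by (intro convex_onD[OF convex]) auto
  moreover have "G (t * x) = G (t * \<bar>x\<bar>)"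
    using that by (metis abs abs_mult abs_of_nonneg)
  ultimately show ?thesis
    by simp
qed

lemma dilate: "a * G x \<le> G (a * x)" if "1 \<le> a"
  using contract[of "1 / a" "a * x"] that by (simp add: field_simps)

lemma le_self: "G x \<le> \<bar>x\<bar>" if "\<bar>x\<bar> \<le> 1"
  using contract[of "\<bar>x\<bar>" 1] that by simp

lemma linear_bound: "\<exists>s\<ge>1. \<forall>x\<ge>1. G x \<le> s * x"
proof -
  obtain s where s: "s > 0" "\<And>x. x > 1 \<Longrightarrow> G x = s * x + (1 - s)"
    using property_P unfolding property_P_def by blast
  \<comment> \<open>Convexity forces slope at least \<open>1\<close>, since
    \<open>G 2 \<ge> 2 * G 1\<close> while \<open>G 2 = s + 1\<close>. The constant term
    \<open>1 - s\<close> can then be dropped from an upper bound.\<close>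
  have "2 \<le> s * 2 + (1 - s)"
    using dilate[of 2 1] s(2)[of 2] by simp
  then have "s \<ge> 1"
    by simp
  moreover have "G x \<le> s * x" if "x \<ge> 1" for x
    using s(2)[of x] that \<open>s \<ge> 1\<close> by (cases "x = 1") auto
  ultimately show ?thesis
    by blast
qed

text \<open>For \<open>\<bar>x\<bar> > 1\<close>, \<open>dilate\<close> gives
  \<open>G x \<ge> \<bar>x\<bar> > 1\<close>. This is why coordinates of vectors in the unit ball
  lie in \<open>[-1, 1]\<close>.\<close>

lemma le_one_iff: "G x \<le> 1 \<longleftrightarrow> \<bar>x\<bar> \<le> 1"
proof
  assume "\<bar>x\<bar> \<le> 1"
  then show "G x \<le> 1"
    using mono[of x 1] by simp
next
  assume *: "G x \<le> 1"
  show "\<bar>x\<bar> \<le> 1"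
    using dilate[of "\<bar>x\<bar>" 1] * by (cases "\<bar>x\<bar> \<le> 1") auto
qed

text \<open>Convexity gives continuity on the open half-line only. Evenness reflects it to negative
  arguments, and \<open>G x \<le> \<bar>x\<bar>\<close> squeezes \<open>G\<close> at
  \<open>0\<close>.\<close>

lemma isCont: "isCont G x"
proof -
  have cont_pos: "isCont G x" if "x > 0" for x
  proof -
    have "convex_on {0<..} G"
      using convex by (rule convex_on_subset) auto
    then have "continuous_on {0<..} G"
      by (intro convex_on_continuous) auto
    then show ?thesis
      using that by (simp add: continuous_on_eq_continuous_at)
  qed
  consider "x > 0" | "x = 0" | "x < 0"
    by linarith
  then show ?thesis
  proof cases
    case 3
    have "isCont (\<lambda>y. G (- y)) x"
      using cont_pos[of "- x"] 3 by (intro continuous_within_compose3[where g = G and f = uminus]) auto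
    then show ?thesis
      by (simp add: even)
  next
    case 2
    have "(G \<longlongrightarrow> 0) (at 0)"
    proof (rule tendsto_sandwich[of "\<lambda>_. 0" G _ "\<lambda>x. \<bar>x\<bar>"])
      show "\<forall>\<^sub>F x in at 0. G x \<le> \<bar>x\<bar>"
        by (rule eventually_at_ball'[THEN eventually_mono, of 1]) (auto simp: dist_real_def intro: le_self)
      show "((\<lambda>x. \<bar>x\<bar>) \<longlongrightarrow> 0) (at (0::real))"
        by (intro tendsto_eq_intros) auto
    qed auto
    then show ?thesis
      using 2 by (simp add: isCont_def)
  qed (rule cont_pos)
qed

lemma borel_measurable [measurable]: "G \<in> borel_measurable borel"
  using isCont by (intro borel_measurable_continuous_onI continuous_at_imp_continuous_on) auto

section \<open>Growth of \<open>G\<close> near \<open>0\<close>\<close>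

lemma derivatives_at_0:
  "\<exists>\<delta>>0. \<exists>a b. (\<forall>x. 0 < x \<and> x < \<delta> \<longrightarrow> G differentiable (at x)) \<and>
     ((\<lambda>x. G x / x) \<longlongrightarrow> a) (at_right 0) \<and>
     ((\<lambda>h. (deriv G h - a) / h) \<longlongrightarrow> b) (at_right 0) \<and> (a > 0 \<or> b > 0)"
proof -
  obtain \<delta> a b where *: "\<delta> > 0" "\<forall>x. 0 < x \<and> x < \<delta> \<longrightarrow> G differentiable (at x)"
    "(G has_real_derivative a) (at_right 0)"
    "((\<lambda>h. (deriv G (0 + h) - a) / h) \<longlongrightarrow> b) (at_right 0)" "a > 0 \<or> b > 0"
    using property_P unfolding property_P_def by blast
  have "((\<lambda>x. G x / x) \<longlongrightarrow> a) (at_right 0)"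
    using *(3) by (simp add: has_field_derivative_iff)
  moreover have "((\<lambda>h. (deriv G h - a) / h) \<longlongrightarrow> b) (at_right 0)"
    using *(4) by simp
  ultimately show ?thesis
    using *(1,2,5) by blast
qed

text \<open>A zero of \<open>G\<close> away from \<open>0\<close> would by monotonicity make
  \<open>G\<close> vanish on an interval around \<open>0\<close>, so both one-sided derivatives at
  \<open>0\<close> would be \<open>0\<close>.\<close>

lemma pos: "0 < G x" if "x \<noteq> 0"
proof (rule ccontr)
  assume "\<not> 0 < G x"
  then have Gx: "G x = 0"
    using nonneg[of x] by linarith
  have vanish: "G y = 0" if "\<bar>y\<bar> < \<bar>x\<bar>" for y
    using mono[of y x] nonneg[of y] that by (simp add: Gx)
  have near: "\<forall>\<^sub>F y in at_right 0. y \<in> {0<..<\<bar>x\<bar>}"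
    using that by (intro eventually_at_right_real) simp
  obtain a b where a: "((\<lambda>x. G x / x) \<longlongrightarrow> a) (at_right 0)"
    and b: "((\<lambda>h. (deriv G h - a) / h) \<longlongrightarrow> b) (at_right 0)" and ab: "a > 0 \<or> b > 0"
    using derivatives_at_0 by blast
  have "((\<lambda>_. 0) \<longlongrightarrow> a) (at_right (0 :: real))"
    by (intro Lim_transform_eventually[OF a] eventually_mono[OF near]) (simp add: vanish)
  then have "a = 0"
    using tendsto_unique[OF trivial_limit_at_right_real _ tendsto_const] by blast
  have "deriv G h = 0" if "0 < h" "h < \<bar>x\<bar>" for h
  proof -
    have "(G has_real_derivative 0) (at h)"
    proof (rule has_field_derivative_transform_within_open[of "\<lambda>_. 0" _ _ "{0<..<\<bar>x\<bar>}"])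
      show "h \<in> {0<..<\<bar>x\<bar>}"
        using that by simp
    qed (auto simp: vanish)
    then show ?thesis
      by (rule DERIV_imp_deriv)
  qed
  then have "((\<lambda>_. 0) \<longlongrightarrow> b) (at_right (0 :: real))"
    by (intro Lim_transform_eventually[OF b] eventually_mono[OF near]) (simp add: \<open>a = 0\<close>)
  then have "b = 0"
    using tendsto_unique[OF trivial_limit_at_right_real _ tendsto_const] by blast
  then show False
    using ab \<open>a = 0\<close> by simp
qed

text \<open>The growth clause with \<open>y = 1\<close> reads
  \<open>1 / G x \<le> C / x^2\<close>.\<close>

lemma quadratic_lower_bound: "\<exists>C\<ge>1. \<forall>x. \<bar>x\<bar> \<le> 1 \<longrightarrow> x\<^sup>2 \<le> C * G x"
proof -
  have "\<exists>C>0. \<forall>x y. 0 < x \<and> x < y \<longrightarrow> G y / G x \<le> C * (y / x)\<^sup>2"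
    using property_P unfolding property_P_def by blast
  then obtain C where C: "C > 0" "\<And>x y. 0 < x \<Longrightarrow> x < y \<Longrightarrow> G y / G x \<le> C * (y / x)\<^sup>2"
    by blast
  have "x\<^sup>2 \<le> max 1 C * G x" if x: "\<bar>x\<bar> \<le> 1" for x
  proof -
    consider "x = 0" | "\<bar>x\<bar> = 1" | "0 < \<bar>x\<bar>" "\<bar>x\<bar> < 1"
      using x by (metis order_le_less zero_less_abs_iff)
    then show ?thesis
    proof cases
      case 2
      then have "G x = 1" "x\<^sup>2 = 1"
        using abs[of x] power2_abs[of x] by simp_all
      then show ?thesis
        by simp
    next
      case 3
      have "1 / G x \<le> C * (1 / \<bar>x\<bar>)\<^sup>2"
        using C(2)[OF 3] by simp
      then have "x\<^sup>2 \<le> C * G x"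
        using 3 pos[of x] by (simp add: field_simps)
      also have "\<dots> \<le> max 1 C * G x"
        by (intro mult_right_mono) auto
      finally show ?thesis .
    qed auto
  qed
  then show ?thesis
    by (intro exI[of _ "max 1 C"]) auto
qed

text \<open>The case split is on the right derivative \<open>a\<close> at \<open>0\<close>. If
  \<open>a > 0\<close>, convexity gives \<open>G x \<ge> a * \<bar>x\<bar>\<close>. If
  \<open>a = 0\<close>, the derivative at small \<open>h\<close> is \<open>O(h)\<close> by the
  second-order limit, and the mean value theorem makes \<open>G\<close> at most quadratic.\<close>

lemma linear_lower_or_quadratic_upper_bound:
  "(\<exists>c>0. \<forall>x. \<bar>x\<bar> \<le> 1 \<longrightarrow> c * \<bar>x\<bar> \<le> G x) \<or> (\<exists>C\<ge>1. \<forall>x. \<bar>x\<bar> \<le> 1 \<longrightarrow> G x \<le> C * x\<^sup>2)"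
proof -
  obtain \<delta> a b where \<delta>: "\<delta> > 0" "\<And>x. 0 < x \<Longrightarrow> x < \<delta> \<Longrightarrow> G differentiable (at x)"
    and a: "((\<lambda>x. G x / x) \<longlongrightarrow> a) (at_right 0)"
    and b: "((\<lambda>h. (deriv G h - a) / h) \<longlongrightarrow> b) (at_right 0)"
    using derivatives_at_0 by blast
  have a_le: "a * x \<le> G x" if "x > 0" for x
  proof -
    \<comment> \<open>The slope of a chord from the origin increases with its endpoint, so the limit
      \<open>a\<close> lies below every such slope.\<close>
    have "G y / y \<le> G x / x" if "y \<in> {0<..<x}" for y
      using contract[of "y / x" x] that \<open>x > 0\<close> by (simp add: field_simps)
    then have "a \<le> G x / x"
      using eventually_at_right_real[OF that] by (intro tendsto_upperbound[OF a]) (auto elim: eventually_mono)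
    then show ?thesis
      using that by (simp add: field_simps)
  qed
  have "a \<ge> 0"
    by (rule tendsto_lowerbound[OF a]) (auto intro!: eventually_at_rightI[of 0 1])
  show ?thesis
  proof (cases "a = 0")
    case False
    have "a * \<bar>x\<bar> \<le> G x" for x
      using a_le[of "\<bar>x\<bar>"] by (cases "x = 0") auto
    then show ?thesis
      using False \<open>a \<ge> 0\<close> by (intro disjI1 exI[of _ a]) auto
  next
    case True
    \<comment> \<open>Strictly above the limit \<open>b\<close>, hence an eventual bound for the
      quotient, and at least \<open>1\<close>, which gives \<open>C \<ge> 1\<close> below.\<close>
    define c where "c = \<bar>b\<bar> + 1"
    have "\<forall>\<^sub>F h in at_right 0. deriv G h / h < c"
      using b True by (intro order_tendstoD(2)[of _ b]) (auto simp: c_def)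
    then obtain e0 where e0: "e0 > 0" "\<And>h. 0 < h \<Longrightarrow> h < e0 \<Longrightarrow> deriv G h / h < c"
      unfolding eventually_at_right_field by auto
    define e where "e = min e0 (min \<delta> 1)"
    have e: "0 < e" "e \<le> 1"
      using e0 \<delta> by (auto simp: e_def)
    have small: "G x \<le> c * x\<^sup>2" if x: "0 < x" "x < e" for x
    proof -
      have "\<exists>l z. 0 < z \<and> z < x \<and> DERIV G z :> l \<and> G x - G 0 = (x - 0) * l"
        using x \<delta>(2) isCont
        by (intro MVT) (auto simp: e_def intro: continuous_at_imp_continuous_on)
      then obtain z where z: "0 < z" "z < x" "G x = x * deriv G z"
        by (auto dest: DERIV_imp_deriv)
      have "deriv G z \<le> c * z"
        using e0(2)[of z] z x by (simp add: e_def field_simps)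
      also have "\<dots> \<le> c * x"
        using z by (intro mult_left_mono) (auto simp: c_def)
      finally show ?thesis
        using x z(3) by (simp add: power2_eq_square)
    qed
    define C where "C = max c (1 / e\<^sup>2)"
    have "1 \<le> C"
      by (simp add: C_def c_def)
    moreover have "G x \<le> C * x\<^sup>2" if "\<bar>x\<bar> \<le> 1" for x
    proof -
      consider "x = 0" | "0 < \<bar>x\<bar>" "\<bar>x\<bar> < e" | "e \<le> \<bar>x\<bar>"
        by (metis not_less zero_less_abs_iff)
      then show ?thesis
      proof cases
        case 2
        have "G x \<le> c * x\<^sup>2"
          using small[OF 2] by simp
        also have "\<dots> \<le> C * x\<^sup>2"
          by (intro mult_right_mono) (auto simp: C_def)
        finally show ?thesis .
      next
        case 3
        have "G x \<le> 1"
          using that by (simp add: le_one_iff)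
        also have "1 \<le> (1 / e\<^sup>2) * x\<^sup>2"
          using 3 e power_mono[of e "\<bar>x\<bar>" 2] by (simp add: field_simps)
        also have "\<dots> \<le> C * x\<^sup>2"
          by (intro mult_right_mono) (auto simp: C_def)
        finally show ?thesis .
      qed simp
    qed
    ultimately show ?thesis
      by blast
  qed
qed

section \<open>Supermultiplicativity up to a constant\<close>

text \<open>On \<open>[-1, 1]\<close>, \<open>G\<close> is comparable up to constants to
  \<open>\<bar>x\<bar>\<close> or to \<open>x^2\<close>, by the preceding dichotomy together with
  \<open>le_self\<close> or the quadratic lower bound. Both of these model functions are
  multiplicative.\<close>

lemma supermultiplicative_unit_interval:
  "\<exists>\<alpha>\<ge>1. \<forall>a b. \<bar>a\<bar> \<le> 1 \<longrightarrow> \<bar>b\<bar> \<le> 1 \<longrightarrow> G a * G b \<le> \<alpha> * G (a * b)"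
  using linear_lower_or_quadratic_upper_bound
proof (elim disjE exE conjE)
  fix c assume c: "0 < c" "\<forall>x. \<bar>x\<bar> \<le> 1 \<longrightarrow> c * \<bar>x\<bar> \<le> G x"
  have "c \<le> 1"
    using c(2)[rule_format, of 1] by simp
  have "G a * G b \<le> (1 / c) * G (a * b)" if ab: "\<bar>a\<bar> \<le> 1" "\<bar>b\<bar> \<le> 1" for a b
  proof -
    have "G a * G b \<le> \<bar>a\<bar> * \<bar>b\<bar>"
      using ab by (intro mult_mono le_self) auto
    moreover have "c * \<bar>a * b\<bar> \<le> G (a * b)"
      using ab c(2)[rule_format, of "a * b"] by (simp add: abs_mult mult_le_one)
    ultimately show ?thesis
      using c(1) by (simp add: field_simps abs_mult) (smt (verit) mult_left_mono)
  qed
  then show ?thesis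
    using c \<open>c \<le> 1\<close> by (intro exI[of _ "1 / c"]) auto
next
  fix C assume C: "1 \<le> C" "\<forall>x. \<bar>x\<bar> \<le> 1 \<longrightarrow> G x \<le> C * x\<^sup>2"
  obtain C' where C': "1 \<le> C'" "\<forall>x. \<bar>x\<bar> \<le> 1 \<longrightarrow> x\<^sup>2 \<le> C' * G x"
    using quadratic_lower_bound by blast
  have "G a * G b \<le> (C * C * C') * G (a * b)" if ab: "\<bar>a\<bar> \<le> 1" "\<bar>b\<bar> \<le> 1" for a b
  proof -
    have "G a * G b \<le> (C * a\<^sup>2) * (C * b\<^sup>2)"
      using ab C by (intro mult_mono) auto
    also have "\<dots> = (C * C) * (a * b)\<^sup>2"
      by (simp add: power_mult_distrib)
    also have "\<dots> \<le> (C * C) * (C' * G (a * b))"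
      using ab C C' by (intro mult_left_mono) (auto simp: abs_mult mult_le_one)
    finally show ?thesis
      by (simp add: mult.assoc)
  qed
  moreover have "1 \<le> C * C * C'"
    using C(1) C'(1) by (meson mult_ge1_I)
  ultimately show ?thesis
    by blast
qed

text \<open>If one argument, say \<open>a\<close>, has modulus at least \<open>1\<close>, linear
  growth gives \<open>G a \<le> s * \<bar>a\<bar>\<close> and convexity moves
  \<open>\<bar>a\<bar>\<close> inside \<open>G b\<close>. The remaining case is the unit
  interval.\<close>

lemma supermultiplicative: "\<exists>\<alpha>\<ge>1. \<forall>a b. G a * G b \<le> \<alpha> * G (a * b)"
proof -
  obtain \<alpha> where \<alpha>: "\<alpha> \<ge> 1" "\<And>a b. \<bar>a\<bar> \<le> 1 \<Longrightarrow> \<bar>b\<bar> \<le> 1 \<Longrightarrow> G a * G b \<le> \<alpha> * G (a * b)"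
    using supermultiplicative_unit_interval by blast
  obtain s where s: "s \<ge> 1" "\<And>x. x \<ge> 1 \<Longrightarrow> G x \<le> s * x"
    using linear_bound by blast
  have large: "G a * G b \<le> s * G (a * b)" if "1 \<le> \<bar>a\<bar>" for a b
  proof -
    have "G a * G b \<le> (s * \<bar>a\<bar>) * G b"
      using s(2)[OF that] by (intro mult_right_mono) auto
    also have "\<dots> = s * (\<bar>a\<bar> * G \<bar>b\<bar>)"
      by simp
    also have "\<dots> \<le> s * G (\<bar>a\<bar> * \<bar>b\<bar>)"
      using s(1) that by (intro mult_left_mono dilate) auto
    also have "\<dots> = s * G (a * b)"
      by (simp flip: abs_mult)
    finally show ?thesis .
  qed
  have "G a * G b \<le> max \<alpha> s * G (a * b)" for a b
  proof -
    consider "1 \<le> \<bar>a\<bar>" | "1 \<le> \<bar>b\<bar>" | "\<bar>a\<bar> \<le> 1" "\<bar>b\<bar> \<le> 1"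
      by linarith
    then have "G a * G b \<le> \<alpha> * G (a * b) \<or> G a * G b \<le> s * G (a * b)"
      using large[of a b] large[of b a] \<alpha>(2)[of a b] by cases (auto simp: mult.commute)
    moreover have "\<alpha> * G (a * b) \<le> max \<alpha> s * G (a * b)" "s * G (a * b) \<le> max \<alpha> s * G (a * b)"
      by (auto intro: mult_right_mono)
    ultimately show ?thesis
      by linarith
  qed
  then show ?thesis
    using \<alpha>(1) by (intro exI[of _ "max \<alpha> s"]) auto
qed

section \<open>The Orlicz norm and its unit ball\<close>

lemma orlicz_norm_eq:
  "orlicz_norm G y = Inf {\<alpha>. 0 < \<alpha> \<and> (\<Sum>i<dim_vec y. G (vec_index y i / \<alpha>)) \<le> 1}"
proof -
  have "G (\<bar>vec_index y i\<bar> / \<alpha>) = G (vec_index y i / \<alpha>)" if "\<alpha> > 0" for i and \<alpha> :: real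
    using that by (metis abs abs_divide abs_of_pos)
  then show ?thesis
    unfolding orlicz_norm_def by (intro arg_cong[of _ _ Inf] Collect_cong) (simp cong: conj_cong)
qed

lemma orlicz_norm_le:
  assumes "0 < \<beta>" "(\<Sum>i<dim_vec y. G (vec_index y i / \<beta>)) \<le> 1"
  shows "orlicz_norm G y \<le> \<beta>"
  unfolding orlicz_norm_eq using assms by (intro cInf_lower bdd_belowI[of _ 0]) auto

lemma gauge_nonempty: "\<exists>\<alpha>>0. (\<Sum>i<dim_vec y. G (vec_index y i / \<alpha>)) \<le> 1"
proof -
  \<comment> \<open>Dividing by more than the sum of absolute values brings every coordinate into
    \<open>[-1, 1]\<close>, where \<open>G\<close> is at most the modulus; the \<open>1\<close>
    keeps \<open>\<alpha>\<close> positive for the zero vector.\<close>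
  define \<alpha> where "\<alpha> = 1 + (\<Sum>i<dim_vec y. \<bar>vec_index y i\<bar>)"
  have \<alpha>: "\<alpha> > 0"
    unfolding \<alpha>_def by (intro add_pos_nonneg sum_nonneg) auto
  have "G (vec_index y i / \<alpha>) \<le> \<bar>vec_index y i\<bar> / \<alpha>" if "i < dim_vec y" for i
  proof -
    have "\<bar>vec_index y i\<bar> \<le> (\<Sum>i<dim_vec y. \<bar>vec_index y i\<bar>)"
      using that by (intro member_le_sum) auto
    then have "\<bar>vec_index y i / \<alpha>\<bar> \<le> 1"
      using \<alpha> by (simp add: \<alpha>_def)
    then show ?thesis
      using le_self \<alpha> by fastforce
  qed
  then have "(\<Sum>i<dim_vec y. G (vec_index y i / \<alpha>)) \<le> (\<Sum>i<dim_vec y. \<bar>vec_index y i\<bar> / \<alpha>)"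
    by (intro sum_mono) auto
  also have "\<dots> \<le> 1"
    using \<alpha> by (simp add: sum_divide_distrib[symmetric] \<alpha>_def)
  finally show ?thesis
    using \<alpha> by blast
qed

text \<open>The infimum is attained when it is positive: the sum is at most \<open>1\<close> at
  every \<open>t > \<beta>\<close>, and continuity of \<open>G\<close> carries this to
  \<open>\<beta>\<close>.\<close>

lemma orlicz_norm_le_iff:
  assumes \<beta>: "0 < \<beta>"
  shows "orlicz_norm G y \<le> \<beta> \<longleftrightarrow> (\<Sum>i<dim_vec y. G (vec_index y i / \<beta>)) \<le> 1"
proof
  assume le: "orlicz_norm G y \<le> \<beta>"
  have "(\<Sum>i<dim_vec y. G (vec_index y i / t)) \<le> 1" if "\<beta> < t" for t
  proof -
    have "Inf {\<alpha>. 0 < \<alpha> \<and> (\<Sum>i<dim_vec y. G (vec_index y i / \<alpha>)) \<le> 1} < t"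
      using le that unfolding orlicz_norm_eq by simp
    then obtain \<alpha> where \<alpha>: "0 < \<alpha>" "(\<Sum>i<dim_vec y. G (vec_index y i / \<alpha>)) \<le> 1" "\<alpha> < t"
      using cInf_lessD[of "{\<alpha>. 0 < \<alpha> \<and> (\<Sum>i<dim_vec y. G (vec_index y i / \<alpha>)) \<le> 1}" t]
        gauge_nonempty[of y] by blast
    have "(\<Sum>i<dim_vec y. G (vec_index y i / t)) \<le> (\<Sum>i<dim_vec y. G (vec_index y i / \<alpha>))"
      using \<alpha> by (intro sum_mono mono) (auto simp: abs_divide intro!: divide_left_mono)
    then show ?thesis
      using \<alpha> by simp
  qed
  then have "\<forall>\<^sub>F t in at_right \<beta>. (\<Sum>i<dim_vec y. G (vec_index y i / t)) \<le> 1"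
    by (auto simp: eventually_at_right_field intro: exI[of _ "\<beta> + 1"])
  moreover have "((\<lambda>t. \<Sum>i<dim_vec y. G (vec_index y i / t)) \<longlongrightarrow> (\<Sum>i<dim_vec y. G (vec_index y i / \<beta>))) (at_right \<beta>)"
    using \<beta> by (intro tendsto_sum isCont_tendsto_compose[OF isCont] tendsto_intros) auto
  ultimately show "(\<Sum>i<dim_vec y. G (vec_index y i / \<beta>)) \<le> 1"
    by (intro tendsto_upperbound) auto
qed (rule orlicz_norm_le[OF \<beta>])

text \<open>Homogeneity reduces the comparison of norms to unit balls. The converse rescales
  \<open>x\<close> by every feasible \<open>\<beta>\<close> instead of by the norm, so vectors of
  norm \<open>0\<close> form no separate case.\<close>

lemma orlicz_norm_mult_le_iff:
  assumes A: "A \<in> carrier_mat n m" and M: "M \<in> carrier_mat p m" and K: "0 < K"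
  shows "(\<forall>x\<in>carrier_vec m. orlicz_norm G (M *\<^sub>v x) \<le> K * orlicz_norm G (A *\<^sub>v x)) \<longleftrightarrow>
    (\<forall>x\<in>carrier_vec m. (\<Sum>i<n. G (vec_index (A *\<^sub>v x) i)) \<le> 1 \<longrightarrow>
      (\<Sum>i<p. G (vec_index (M *\<^sub>v x) i / K)) \<le> 1)"
proof (intro iffI ballI impI)
  fix x :: "real Matrix.vec"
  assume *: "\<forall>x\<in>carrier_vec m. orlicz_norm G (M *\<^sub>v x) \<le> K * orlicz_norm G (A *\<^sub>v x)"
    and x: "x \<in> carrier_vec m" and "(\<Sum>i<n. G (vec_index (A *\<^sub>v x) i)) \<le> 1"
  then have "orlicz_norm G (A *\<^sub>v x) \<le> 1"
    using A by (intro orlicz_norm_le) auto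
  then have "K * orlicz_norm G (A *\<^sub>v x) \<le> K"
    using K by (simp add: mult_le_cancel_left1)
  then have "orlicz_norm G (M *\<^sub>v x) \<le> K"
    using * x by fastforce
  then show "(\<Sum>i<p. G (vec_index (M *\<^sub>v x) i / K)) \<le> 1"
    using orlicz_norm_le_iff[OF K] M by simp
next
  fix x :: "real Matrix.vec"
  assume *: "\<forall>x\<in>carrier_vec m. (\<Sum>i<n. G (vec_index (A *\<^sub>v x) i)) \<le> 1 \<longrightarrow>
      (\<Sum>i<p. G (vec_index (M *\<^sub>v x) i / K)) \<le> 1" and x: "x \<in> carrier_vec m"
  have "orlicz_norm G (M *\<^sub>v x) / K \<le> \<beta>"
    if \<beta>: "0 < \<beta>" "(\<Sum>i<n. G (vec_index (A *\<^sub>v x) i / \<beta>)) \<le> 1" for \<beta>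
  proof -
    have "(1 / \<beta>) \<cdot>\<^sub>v x \<in> carrier_vec m" "A *\<^sub>v ((1 / \<beta>) \<cdot>\<^sub>v x) = (1 / \<beta>) \<cdot>\<^sub>v (A *\<^sub>v x)"
        "M *\<^sub>v ((1 / \<beta>) \<cdot>\<^sub>v x) = (1 / \<beta>) \<cdot>\<^sub>v (M *\<^sub>v x)"
      using x mult_mat_vec[OF A x] mult_mat_vec[OF M x] by auto
    moreover have "(\<Sum>i<n. G (vec_index ((1 / \<beta>) \<cdot>\<^sub>v (A *\<^sub>v x)) i)) \<le> 1"
      using \<beta>(2) A by simp
    ultimately have "(\<Sum>i<p. G (vec_index ((1 / \<beta>) \<cdot>\<^sub>v (M *\<^sub>v x)) i / K)) \<le> 1"
      using * by metis
    then have "(\<Sum>i<p. G (vec_index (M *\<^sub>v x) i / (\<beta> * K))) \<le> 1"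
      using M by simp
    then have "orlicz_norm G (M *\<^sub>v x) \<le> \<beta> * K"
      using M \<beta> K by (intro orlicz_norm_le) auto
    then show ?thesis
      using K by (simp add: field_simps)
  qed
  then have "orlicz_norm G (M *\<^sub>v x) / K \<le> orlicz_norm G (A *\<^sub>v x)"
    unfolding orlicz_norm_eq[of "A *\<^sub>v x"] using gauge_nonempty[of "A *\<^sub>v x"] A
    by (intro cInf_greatest) auto
  then show "orlicz_norm G (M *\<^sub>v x) \<le> K * orlicz_norm G (A *\<^sub>v x)"
    using K by (simp add: field_simps)
qed

lemma orlicz_norm_zero: "orlicz_norm G (0\<^sub>v n) = 0"
proof -
  have "{\<alpha>. 0 < \<alpha> \<and> (\<Sum>i<n. G (vec_index (0\<^sub>v n) i / \<alpha>)) \<le> 1} = {0<..}"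
    by auto
  then show ?thesis
    unfolding orlicz_norm_eq by simp
qed

text \<open>
  The event of the theorem is an intersection over uncountably many vectors; this makes it measurable.
\<close>

lemma countable_ball_reduction:
  fixes S :: "(nat \<Rightarrow> real) set"
  shows "\<exists>T. countable T \<and>
    (\<forall>c. (\<forall>y\<in>S. (\<Sum>i<n. G (y i * c i)) \<le> 1) \<longleftrightarrow> (\<forall>y\<in>T. (\<Sum>i<n. G (y i * c i)) \<le> 1))"
proof -
  \<comment> \<open>\<open>T\<close> is dense in \<open>S\<close> for the product topology. For each
    \<open>c\<close> the condition is closed in \<open>y\<close>, so it passes from \<open>T\<close>
    to \<open>S\<close>; the same \<open>T\<close> serves all \<open>c\<close>, hence all sample
    points.\<close>
  obtain T where T: "countable T" "T \<subseteq> S" "S \<subseteq> closure T"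
    using separable by blast
  have "closed {y. (\<Sum>i<n. G (y i * c i)) \<le> 1}" for c :: "nat \<Rightarrow> real"
  proof (intro closed_Collect_le continuous_intros)
    fix i
    have "continuous_on UNIV G"
      using isCont by (intro continuous_at_imp_continuous_on) auto
    moreover have "continuous_on UNIV (\<lambda>y :: nat \<Rightarrow> real. y i * c i)"
      by (intro continuous_intros continuous_on_product_coordinates)
    ultimately show "continuous_on UNIV (\<lambda>y :: nat \<Rightarrow> real. G (y i * c i))"
      by (rule continuous_on_compose2) auto
  qed
  then have "closure T \<subseteq> {y. (\<Sum>i<n. G (y i * c i)) \<le> 1}" if "\<forall>y\<in>T. (\<Sum>i<n. G (y i * c i)) \<le> 1"
    for c :: "nat \<Rightarrow> real"
    using that by (intro closure_minimal) auto
  then have "(\<forall>y\<in>S. (\<Sum>i<n. G (y i * c i)) \<le> 1) \<longleftrightarrow> (\<forall>y\<in>T. (\<Sum>i<n. G (y i * c i)) \<le> 1)" for c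
    using T by blast
  then show ?thesis
    using T(1) by blast
qed

section \<open>Dilation for fixed diagonal entries\<close>

text \<open>Supermultiplicativity at \<open>w\<close> and \<open>y / w\<close> gives
  \<open>G (y / w) \<le> \<alpha> * G y / G w\<close>, and \<open>contract\<close> takes out the
  factor \<open>1 / T\<close>.\<close>

lemma quotient_le:
  assumes super: "\<And>a b. G a * G b \<le> \<alpha> * G (a * b)" and w: "w \<noteq> 0" and T: "1 \<le> T"
  shows "G (y / (w * T)) \<le> \<alpha> / T * (G y / G w)"
proof -
  have "G (y / (w * T)) \<le> (1 / T) * G (y / w)"
    using contract[of "1 / T" "y / w"] T by (simp add: field_simps)
  also have "G (y / w) \<le> \<alpha> * (G y / G w)"
    using super[of w "y / w"] pos[OF w] w by (simp add: field_simps)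
  finally show ?thesis
    using T by (simp add: field_simps)
qed

text \<open>Coefficients are at most \<open>2\<close>, so after division by \<open>2 * d\<close> the
  modulus of \<open>y i\<close> is at most an average of the \<open>d\<close> moduli
  \<open>\<bar>Y j i\<bar>\<close>, and Jensen's inequality applies. With
  \<open>T = \<alpha> * c\<close>, the total is
  \<open>\<alpha> / (d * T) * (d * c) = 1\<close>.\<close>

lemma combination_le:
  assumes super: "\<And>a b. G a * G b \<le> \<alpha> * G (a * b)" and \<alpha>: "1 \<le> \<alpha>" and c: "1 \<le> c"
    and d: "0 < d" and w: "\<And>i. i < n \<Longrightarrow> w i \<noteq> 0"
    and bound: "(\<Sum>j<d. \<Sum>i<n. G (Y j i) / G (w i)) \<le> real d * c"
    and x: "\<And>j. j < d \<Longrightarrow> \<bar>x j\<bar> \<le> 2" and y: "\<And>i. i < n \<Longrightarrow> y i = (\<Sum>j<d. x j * Y j i)"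
  shows "(\<Sum>i<n. G (y i / (w i * (2 * real d * (\<alpha> * c))))) \<le> 1"
proof -
  define T where "T = \<alpha> * c"
  have T: "1 \<le> T"
    using \<alpha> c mult_mono[of 1 \<alpha> 1 c] by (simp add: T_def)
  have "G (y i / (w i * (2 * real d * T))) \<le> (\<Sum>j<d. 1 / real d * (\<alpha> / T * (G (Y j i) / G (w i))))"
    if i: "i < n" for i
  proof -
    have "\<bar>y i\<bar> \<le> (\<Sum>j<d. \<bar>x j * Y j i\<bar>)"
      unfolding y[OF i] by (rule sum_abs)
    also have "\<dots> \<le> (\<Sum>j<d. 2 * \<bar>Y j i\<bar>)"
      using x by (intro sum_mono) (auto simp: abs_mult intro: mult_right_mono)
    finally have "\<bar>y i\<bar> \<le> 2 * (\<Sum>j<d. \<bar>Y j i\<bar>)"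
      by (simp add: sum_distrib_left)
    then have "\<bar>y i / (w i * (2 * real d * T))\<bar> \<le> 2 * (\<Sum>j<d. \<bar>Y j i\<bar>) / \<bar>w i * (2 * real d * T)\<bar>"
      unfolding abs_divide by (intro divide_right_mono) auto
    also have "\<dots> = (\<Sum>j<d. 1 / real d * \<bar>Y j i / (w i * T)\<bar>)"
      using T d by (simp add: sum_distrib_left sum_divide_distrib abs_mult field_simps)
    finally have "G (y i / (w i * (2 * real d * T))) \<le> G (\<Sum>j<d. (1 / real d) *\<^sub>R \<bar>Y j i / (w i * T)\<bar>)"
      using d by (intro mono) (auto simp: abs_of_nonneg sum_nonneg)
    also have "\<dots> \<le> (\<Sum>j<d. 1 / real d * G \<bar>Y j i / (w i * T)\<bar>)"
      using d by (intro convex_on_sum[OF _ _ convex]) auto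
    also have "\<dots> = (\<Sum>j<d. 1 / real d * G (Y j i / (w i * T)))"
      by (simp only: abs)
    also have "\<dots> \<le> (\<Sum>j<d. 1 / real d * (\<alpha> / T * (G (Y j i) / G (w i))))"
      using quotient_le[OF super w[OF i] T] by (intro sum_mono mult_left_mono) auto
    finally show ?thesis .
  qed
  then have "(\<Sum>i<n. G (y i / (w i * (2 * real d * T)))) \<le>
      (\<Sum>i<n. \<Sum>j<d. 1 / real d * (\<alpha> / T * (G (Y j i) / G (w i))))"
    by (intro sum_mono) auto
  also have "\<dots> = \<alpha> / (real d * T) * (\<Sum>j<d. \<Sum>i<n. G (Y j i) / G (w i))"
    by (subst sum.swap) (simp add: sum_distrib_left field_simps)
  also have "\<dots> \<le> \<alpha> / (real d * T) * (real d * c)"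
    using \<alpha> T by (intro mult_left_mono bound) auto
  also have "\<dots> = 1"
    using \<alpha> c d by (simp add: T_def)
  finally show ?thesis
    by (simp add: T_def)
qed

end

section \<open>Random diagonal entries\<close>

text \<open>A dyadic majorant of the truncated reciprocal, which needs only tail probabilities to be
  integrated. In the induction, \<open>e\<close> below \<open>(1/2)^K\<close> makes the new summand
  alone large enough; otherwise it vanishes.\<close>

lemma inverse_le_dyadic_sum:
  fixes e :: real
  assumes "(1 / 2) ^ K \<le> e"
  shows "1 / e \<le> 1 + (\<Sum>k<K. 2 ^ Suc k * of_bool (e < (1 / 2) ^ k))"
  using assms
proof (induction K)
  case (Suc K)
  have e: "0 < e"
    using Suc.prems by (smt (verit) zero_less_power half_gt_zero_iff)
  show ?case
  proof (cases "(1 / 2) ^ K \<le> e")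
    case True
    then show ?thesis
      using Suc.IH by simp
  next
    case False
    have "1 / e \<le> 2 ^ Suc K"
      using Suc.prems e by (simp add: field_simps power_one_over)
    moreover have "0 \<le> (\<Sum>k<K. 2 ^ Suc k * of_bool (e < (1 / 2) ^ k) :: real)"
      by (intro sum_nonneg) auto
    ultimately show ?thesis
      using False by simp
  qed
qed (simp add: field_simps)

text \<open>\<open>K\<close> is the ceiling of \<open>log 2 n\<close> plus \<open>8\<close>, since
  \<open>2^8 \<ge> 200\<close>. As \<open>log 2 n \<ge> 1\<close>, the constants are absorbed in
  \<open>21 * log 2 n\<close>, and \<open>log 2 n \<le> 2 * ln n\<close>.\<close>

lemma dyadic_exponent_bound:
  assumes n: "2 \<le> n"
  obtains K :: nat where "200 * real n \<le> 2 ^ K" "1 + 2 * real K \<le> 42 * ln (real n)"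
proof -
  obtain m :: nat where m: "log 2 (real n) \<le> real m" "real m \<le> log 2 (real n) + 1"
  proof
    have "0 \<le> log 2 (real n)"
      using n by simp
    then show "log 2 (real n) \<le> real (nat \<lceil>log 2 (real n)\<rceil>)" "real (nat \<lceil>log 2 (real n)\<rceil>) \<le> log 2 (real n) + 1"
      by linarith+
  qed
  have "real n = 2 powr log 2 (real n)"
    using n by simp
  also have "\<dots> \<le> 2 powr real m"
    using m by (intro powr_mono) auto
  also have "\<dots> = 2 ^ m"
    by (simp add: powr_realpow)
  finally have "real n \<le> 2 ^ m" .
  moreover have "2 ^ (m + 8) = 256 * (2 :: real) ^ m"
    by (simp add: power_add)
  ultimately have "200 * real n \<le> 2 ^ (m + 8)"
    by linarith
  moreover have "1 + 2 * real (m + 8) \<le> 42 * ln (real n)"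
  proof -
    have "1 \<le> log 2 (real n)"
      using n by simp
    then have "1 + 2 * real (m + 8) \<le> 21 * log 2 (real n)"
      using m by simp
    also have "log 2 (real n) \<le> 2 * ln (real n)"
    proof -
      have "1 / 2 \<le> ln (2 :: real)"
        using ln2_ge_two_thirds by simp
      then have "ln (real n) * 1 \<le> ln (real n) * (2 * ln 2)"
        using n by (intro mult_left_mono) auto
      then show ?thesis
        by (simp add: log_def field_simps)
    qed
    finally show ?thesis
      by simp
  qed
  ultimately show thesis
    using that by blast
qed

context orlicz_function
begin

section \<open>Tails and truncated reciprocals of the diagonal entries\<close>

lemma diagonal_law_measurable:
  assumes "diagonal_law G n \<mu>" "i < n"
  shows "(\<lambda>\<omega>. \<omega> i) \<in> borel_measurable \<mu>"
proof -
  have "sets \<mu> = sets (Pi\<^sub>M {..<n} (\<lambda>_. borel))"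
    using assms(1) by (simp add: diagonal_law_def)
  moreover have "(\<lambda>\<omega>. \<omega> i) \<in> measurable (Pi\<^sub>M {..<n} (\<lambda>_. borel :: real measure)) borel"
    using assms(2) by (intro measurable_component_singleton) auto
  ultimately show ?thesis
    by (simp cong: measurable_cong_sets)
qed

text \<open>With \<open>G g = t\<close>, the event lies in \<open>\<omega> i \<le> g\<close>, whose
  probability is \<open>1 - exp (- t) \<le> t\<close>. Nonpositive entries are included because the
  even function \<open>G\<close> does not detect the sign.\<close>

lemma prob_small_le:
  assumes law: "diagonal_law G n \<mu>" and i: "i < n" and t: "0 < t"
  shows "measure \<mu> {\<omega> \<in> space \<mu>. \<omega> i \<le> 0 \<or> G (\<omega> i) < t} \<le> t"
proof -
  interpret prob_space \<mu>
    using law by (simp add: diagonal_law_def)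
  note [measurable] = diagonal_law_measurable[OF law i]
  have "\<exists>g\<ge>0. g \<le> max 1 t \<and> G g = t"
  proof (rule IVT)
    show "t \<le> G (max 1 t)"
      using dilate[of "max 1 t" 1] by simp
  qed (use t isCont in auto)
  then obtain g where g: "0 \<le> g" "G g = t"
    by blast
  have "measure \<mu> {\<omega> \<in> space \<mu>. \<omega> i \<le> 0 \<or> G (\<omega> i) < t} \<le> measure \<mu> {\<omega> \<in> space \<mu>. \<omega> i \<le> g}"
  proof (rule finite_measure_mono)
    show "{\<omega> \<in> space \<mu>. \<omega> i \<le> 0 \<or> G (\<omega> i) < t} \<subseteq> {\<omega> \<in> space \<mu>. \<omega> i \<le> g}"
    proof -
      have "x \<le> g" if "x \<le> 0 \<or> G x < t" for x
        using mono[of g x] g that by (cases "x \<le> g") auto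
      then show ?thesis
        by blast
    qed
  qed measurable
  also have "{\<omega> \<in> space \<mu>. \<omega> i \<le> g} = (\<lambda>\<omega>. \<omega> i) -` {..g} \<inter> space \<mu>"
    by auto
  also have "measure \<mu> \<dots> = cdf (distr \<mu> borel (\<lambda>\<omega>. \<omega> i)) g"
    by (simp add: cdf_def measure_distr)
  also have "\<dots> = 1 - exp (- t)"
    using law i g by (simp add: diagonal_law_def orlicz_cdf_def)
  also have "\<dots> \<le> t"
    using exp_ge_add_one_self[of "- t"] by simp
  finally show ?thesis .
qed

text \<open>Two exceptional events of probability at most \<open>1 / 200\<close> each: some entry
  has \<open>G\<close> below \<open>(1/2)^K\<close> (union bound), or the truncated sum is large
  (Markov). Union bound and linearity of expectation involve the marginals only.\<close>

lemma prob_weighted_sum: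
  assumes law: "diagonal_law G n \<mu>" and d: "0 < d" and n: "0 < n" and K: "200 * real n \<le> 2 ^ K"
    and Y: "\<And>j. j < d \<Longrightarrow> (\<Sum>i<n. G (Y j i)) \<le> 1"
  defines "E \<equiv> {\<omega> \<in> space \<mu>. (\<forall>i<n. 0 < \<omega> i) \<and>
      (\<Sum>j<d. \<Sum>i<n. G (Y j i) / G (\<omega> i)) \<le> real d * (200 * (1 + 2 * real K))}"
  shows "E \<in> sets \<mu>" and "99 / 100 \<le> measure \<mu> E"
proof -
  interpret prob_space \<mu>
    using law by (simp add: diagonal_law_def)
  note [measurable] = diagonal_law_measurable[OF law]
  have [measurable]: "(\<lambda>\<omega>. \<Sum>j<d. \<Sum>i<n. G (Y j i) / G (\<omega> i)) \<in> borel_measurable \<mu>"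
    using diagonal_law_measurable[OF law]
    by (intro borel_measurable_sum borel_measurable_divide borel_measurable_const
        measurable_compose[OF _ borel_measurable]) auto
  show E: "E \<in> sets \<mu>"
    unfolding E_def by measurable
  define bad where "bad i t = {\<omega> \<in> space \<mu>. \<omega> i \<le> 0 \<or> G (\<omega> i) < t}" for i and t :: real
  have bad [measurable]: "bad i t \<in> sets \<mu>" if "i < n" for i t
    unfolding bad_def using that by measurable
  have bad_le: "measure \<mu> (bad i t) \<le> t" if "i < n" "0 < t" for i t
    unfolding bad_def using prob_small_le[OF law that] .
  define B where "B = (\<Union>i<n. bad i ((1 / 2) ^ K))"
  have B: "B \<in> sets \<mu>"
    unfolding B_def using bad by (intro sets.finite_UN) auto
  have "measure \<mu> B \<le> (\<Sum>i<n. measure \<mu> (bad i ((1 / 2) ^ K)))"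
    unfolding B_def using bad by (intro finite_measure_subadditive_finite) auto
  also have "\<dots> \<le> (\<Sum>i<n. (1 / 2) ^ K)"
    by (intro sum_mono bad_le) auto
  also have "\<dots> \<le> 1 / 200"
    using K by (simp add: power_one_over field_simps)
  finally have B_le: "measure \<mu> B \<le> 1 / 200" .
  define L where "L = 1 + 2 * real K"
  \<comment> \<open>Majorant of \<open>1 / G (\<omega> i)\<close> outside \<open>B\<close>; the
    reciprocal itself has infinite expectation. Layer \<open>k\<close> has weight
    \<open>2 ^ Suc k\<close> and probability at most \<open>(1/2)^k\<close>, so it adds at most
    \<open>2\<close> and the expectation is at most \<open>L\<close>.\<close>
  define W where "W i \<omega> = 1 + (\<Sum>k<K. 2 ^ Suc k * indicat_real (bad i ((1 / 2) ^ k)) \<omega>)" for i \<omega>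
  define Z where "Z \<omega> = (\<Sum>j<d. \<Sum>i<n. G (Y j i) * W i \<omega>)" for \<omega>
  have int_W: "integrable \<mu> (W i)"
    and W: "(\<integral>\<omega>. W i \<omega> \<partial>\<mu>) = 1 + (\<Sum>k<K. 2 ^ Suc k * measure \<mu> (bad i ((1 / 2) ^ k)))"
    if i: "i < n" for i
  proof -
    have "integrable \<mu> (indicat_real (bad i t))" for t
      using bad[OF i] by (simp add: less_top[symmetric])
    then have sum: "integrable \<mu> (\<lambda>\<omega>. 2 ^ Suc k * indicat_real (bad i ((1 / 2) ^ k)) \<omega>)" for k
      by (rule integrable_mult_right)
    then have sums: "integrable \<mu> (\<lambda>\<omega>. \<Sum>k<K. 2 ^ Suc k * indicat_real (bad i ((1 / 2) ^ k)) \<omega>)"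
      by (rule Bochner_Integration.integrable_sum)
    show "integrable \<mu> (W i)"
      unfolding W_def by (rule Bochner_Integration.integrable_add[OF integrable_const sums])
    have "(\<integral>\<omega>. W i \<omega> \<partial>\<mu>) = 1 + (\<integral>\<omega>. (\<Sum>k<K. 2 ^ Suc k * indicat_real (bad i ((1 / 2) ^ k)) \<omega>) \<partial>\<mu>)"
      unfolding W_def Bochner_Integration.integral_add[OF integrable_const sums] by (simp add: prob_space)
    also have "(\<integral>\<omega>. (\<Sum>k<K. 2 ^ Suc k * indicat_real (bad i ((1 / 2) ^ k)) \<omega>) \<partial>\<mu>) =
        (\<Sum>k<K. \<integral>\<omega>. 2 ^ Suc k * indicat_real (bad i ((1 / 2) ^ k)) \<omega> \<partial>\<mu>)"
      using sum by (intro Bochner_Integration.integral_sum)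
    also have "\<dots> = (\<Sum>k<K. 2 ^ Suc k * measure \<mu> (bad i ((1 / 2) ^ k)))"
      using bad[OF i] by (intro sum.cong refl) (simp del: power_Suc)
    finally show "(\<integral>\<omega>. W i \<omega> \<partial>\<mu>) = 1 + (\<Sum>k<K. 2 ^ Suc k * measure \<mu> (bad i ((1 / 2) ^ k)))" .
  qed
  have int: "integrable \<mu> Z"
    unfolding Z_def using int_W by (intro Bochner_Integration.integrable_sum integrable_mult_right) auto
  have "(\<integral>\<omega>. Z \<omega> \<partial>\<mu>) = (\<Sum>j<d. \<integral>\<omega>. (\<Sum>i<n. G (Y j i) * W i \<omega>) \<partial>\<mu>)"
    unfolding Z_def using int_W
    by (intro Bochner_Integration.integral_sum Bochner_Integration.integrable_sum integrable_mult_right) auto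
  also have "\<dots> = (\<Sum>j<d. \<Sum>i<n. \<integral>\<omega>. G (Y j i) * W i \<omega> \<partial>\<mu>)"
    using int_W by (intro sum.cong refl Bochner_Integration.integral_sum integrable_mult_right) auto
  also have "\<dots> = (\<Sum>j<d. \<Sum>i<n. G (Y j i) * (\<integral>\<omega>. W i \<omega> \<partial>\<mu>))"
    by simp
  also have "\<dots> \<le> (\<Sum>j<d. \<Sum>i<n. G (Y j i) * L)"
  proof (intro sum_mono mult_left_mono)
    fix i assume "i \<in> {..<n}"
    then have "(\<Sum>k<K. 2 ^ Suc k * measure \<mu> (bad i ((1 / 2) ^ k))) \<le> (\<Sum>k<K. 2 ^ Suc k * (1 / 2) ^ k)"
      by (intro sum_mono mult_left_mono bad_le) auto
    also have "\<dots> = 2 * real K"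
      by (simp add: power_one_over)
    finally show "(\<integral>\<omega>. W i \<omega> \<partial>\<mu>) \<le> L"
      using W[of i] \<open>i \<in> {..<n}\<close> by (simp add: L_def del: power_Suc)
  qed auto
  also have "\<dots> = L * (\<Sum>j<d. \<Sum>i<n. G (Y j i))"
    by (simp add: sum_distrib_left mult.commute)
  also have "\<dots> \<le> L * real d"
    using sum_mono[of "{..<d}" "\<lambda>j. \<Sum>i<n. G (Y j i)" "\<lambda>_. 1"] Y
    by (intro mult_left_mono) (auto simp: L_def)
  finally have "(\<integral>\<omega>. Z \<omega> \<partial>\<mu>) \<le> L * real d" .
  have Z_nonneg: "0 \<le> Z \<omega>" for \<omega>
    unfolding Z_def W_def by (intro sum_nonneg mult_nonneg_nonneg add_nonneg_nonneg) auto
  have L: "0 < L"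
    by (simp add: L_def add_pos_nonneg)
  \<comment> \<open>The threshold is \<open>200\<close> times the bound on the expectation, so
    Markov's inequality gives \<open>1 / 200\<close>.\<close>
  define B' where "B' = {\<omega> \<in> space \<mu>. 200 * (L * real d) \<le> Z \<omega>}"
  have B': "B' \<in> sets \<mu>"
    unfolding B'_def using int by measurable
  have "measure \<mu> B' \<le> (\<integral>\<omega>. Z \<omega> \<partial>\<mu>) / (200 * (L * real d))"
    unfolding B'_def using Z_nonneg L d
    by (intro integral_Markov_inequality_measure[OF int, of "{}"]) auto
  also have "\<dots> \<le> (L * real d) / (200 * (L * real d))"
    using \<open>(\<integral>\<omega>. Z \<omega> \<partial>\<mu>) \<le> L * real d\<close> L d by (intro divide_right_mono) auto
  also have "\<dots> = 1 / 200"
    using L d by simp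
  finally have B'_le: "measure \<mu> B' \<le> 1 / 200" .
  have "space \<mu> - (B \<union> B') \<subseteq> E"
  proof
    fix \<omega> assume \<omega>: "\<omega> \<in> space \<mu> - (B \<union> B')"
    then have good: "0 < \<omega> i" "(1 / 2) ^ K \<le> G (\<omega> i)" if "i < n" for i
      using that by (auto simp: B_def bad_def not_le not_less)
    have "1 / G (\<omega> i) \<le> W i \<omega>"
      if i: "i < n" for i
    proof -
      have "indicat_real (bad i ((1 / 2) ^ k)) \<omega> = of_bool (G (\<omega> i) < (1 / 2) ^ k)" for k
        using good[OF i] \<omega> by (auto simp: bad_def indicator_def)
      then show ?thesis
        using inverse_le_dyadic_sum[OF good(2)[OF i]] by (simp add: W_def)
    qed
    then have "(\<Sum>j<d. \<Sum>i<n. G (Y j i) * (1 / G (\<omega> i))) \<le> Z \<omega>"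
      unfolding Z_def by (intro sum_mono mult_left_mono) auto
    also have "\<dots> \<le> 200 * (L * real d)"
      using \<omega> by (auto simp: B'_def)
    finally show "\<omega> \<in> E"
      using good \<omega> by (simp add: E_def L_def mult_ac)
  qed
  then have "measure \<mu> (space \<mu> - (B \<union> B')) \<le> measure \<mu> E"
    using E by (rule finite_measure_mono)
  moreover have "measure \<mu> (space \<mu> - (B \<union> B')) = 1 - measure \<mu> (B \<union> B')"
    using B B' by (intro prob_compl) auto
  moreover have "measure \<mu> (B \<union> B') \<le> measure \<mu> B + measure \<mu> B'"
    using B B' by (rule measure_Un_le)
  ultimately show "99 / 100 \<le> measure \<mu> E"
    using B_le B'_le by linarith
qed

end

section \<open>Dilation by the inverse of a random diagonal matrix\<close>

text \<open>\<open>mat_inverse\<close> is specified as returning a two-sided inverse whenever one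
  exists; uniqueness of inverses identifies it with the explicit diagonal matrix.\<close>

lemma mat_inv_mat_diag:
  assumes "\<And>i. i < n \<Longrightarrow> \<omega> i \<noteq> 0"
  shows "mat_inv (mat_diag n \<omega>) = mat_diag n (\<lambda>i. 1 / \<omega> i)"
proof -
  let ?D = "mat_diag n \<omega>" and ?E = "mat_diag n (\<lambda>i. 1 / \<omega> i)"
  have one: "mat_diag n (\<lambda>i. \<omega> i * (1 / \<omega> i)) = 1\<^sub>m n" "mat_diag n (\<lambda>i. 1 / \<omega> i * \<omega> i) = 1\<^sub>m n"
    using assms by (auto simp: mat_diag_def intro!: eq_matI)
  have DE: "?D * ?E = 1\<^sub>m n" "?E * ?D = 1\<^sub>m n"
    unfolding mat_diag_diag by (rule one)+
  have "?D \<in> Units (ring_mat TYPE(real) n b)" for b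
    unfolding Units_def ring_mat_def using DE by (auto intro!: bexI[of _ ?E])
  then obtain B where B: "mat_inverse ?D = Some B"
    using mat_inverse(1)[OF mat_diag_dim] by fastforce
  then have "B * ?D = 1\<^sub>m n" "B \<in> carrier_mat n n"
    using mat_inverse(2)[OF mat_diag_dim] by blast+
  then have "B = (B * ?D) * ?E"
    using DE(1) assoc_mult_mat[of B n n ?D n ?E n] right_mult_one_mat[of B n n] by simp
  also have "\<dots> = ?E"
    unfolding \<open>B * ?D = 1\<^sub>m n\<close> by (rule left_mult_one_mat[OF mat_diag_dim])
  finally have "B = ?E" .
  then show ?thesis
    by (simp add: mat_inv_def B)
qed

text \<open>On singular matrices the unspecified value does not vary with \<open>\<omega>\<close>,
  which keeps the event of the theorem measurable there.\<close>

lemma mat_inv_mat_diag_singular: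
  assumes "i < n" "\<omega> i = 0"
  shows "mat_inv (mat_diag n \<omega>) = the None"
proof -
  have "mat_inverse (mat_diag n \<omega>) \<noteq> Some B" for B
  proof
    assume "mat_inverse (mat_diag n \<omega>) = Some B"
    then have B: "mat_diag n \<omega> * B = 1\<^sub>m n" "B \<in> carrier_mat n n"
      using mat_inverse(2)[OF mat_diag_dim] by blast+
    have "(mat_diag n \<omega> * B) $$ (i, i) = 0"
      using assms B(2) by (simp add: mat_diag_mult_left[OF B(2)])
    then show False
      using B(1) assms by simp
  qed
  then have "mat_inverse (mat_diag n \<omega>) = None"
    by (cases "mat_inverse (mat_diag n \<omega>)") auto
  then show ?thesis
    by (simp add: mat_inv_def)
qed

text \<open>The column basis is empty, so every image is an empty combination. For
  \<open>d = 0\<close> the claimed bound is \<open>0\<close>, and this makes it true.\<close>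

lemma rank_zero_mult:
  fixes A :: "'a::field mat"
  assumes A: "A \<in> carrier_mat n m" and rank: "vec_space.rank n A = 0" and x: "x \<in> carrier_vec m"
  shows "A *\<^sub>v x = 0\<^sub>v n"
proof -
  obtain B where B: "B \<in> carrier_mat n 0" and "(\<lambda>x. A *\<^sub>v x) ` carrier_vec m = (\<lambda>c. B *\<^sub>v c) ` carrier_vec 0"
    using rank_column_basis[OF A] rank by metis
  then obtain c where "c \<in> carrier_vec 0" "A *\<^sub>v x = B *\<^sub>v c"
    using x by blast
  then show ?thesis
    using B by (auto simp: scalar_prod_def)
qed

context orlicz_function
begin

section \<open>The dilation event and its measurability\<close>

text \<open>Brings the event to the form \<open>G (y i * c i)\<close> with \<open>c\<close>
  depending on \<open>\<omega>\<close> and \<open>y\<close> not, as the countable reduction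
  requires.\<close>

lemma mat_diag_mult_norm_le_iff:
  fixes A :: "real mat"
  assumes A: "A \<in> carrier_mat n m" and K: "0 < K"
  shows "(\<forall>x\<in>carrier_vec m. orlicz_norm G ((mat_diag n (\<lambda>i. 1 / \<omega> i) * A) *\<^sub>v x) \<le> K * orlicz_norm G (A *\<^sub>v x)) \<longleftrightarrow>
    (\<forall>x\<in>carrier_vec m. (\<Sum>i<n. G (vec_index (A *\<^sub>v x) i)) \<le> 1 \<longrightarrow>
      (\<Sum>i<n. G (vec_index (A *\<^sub>v x) i / (\<omega> i * K))) \<le> 1)"
proof -
  let ?M = "mat_diag n (\<lambda>i. 1 / \<omega> i) * A"
  have M: "?M \<in> carrier_mat n m"
    using A by (intro mult_carrier_mat[of _ n n]) auto
  have "vec_index (?M *\<^sub>v x) i / K = vec_index (A *\<^sub>v x) i / (\<omega> i * K)"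
    if "x \<in> carrier_vec m" "i < n" for x i
  proof -
    have "vec_index (?M *\<^sub>v x) i = 1 / \<omega> i * vec_index (A *\<^sub>v x) i"
      using that A by (simp add: mat_diag_mult_left[OF A] scalar_prod_def sum_distrib_left mult.assoc del: assoc_mult_mat_vec)
    then show ?thesis
      by simp
  qed
  then have "(\<Sum>i<n. G (vec_index (?M *\<^sub>v x) i / K)) = (\<Sum>i<n. G (vec_index (A *\<^sub>v x) i / (\<omega> i * K)))"
    if "x \<in> carrier_vec m" for x
    using that by (intro sum.cong) auto
  then show ?thesis
    unfolding orlicz_norm_mult_le_iff[OF A M K] by simp
qed

lemma mat_diag_mult_norm_rank_zero:
  fixes A :: "real mat"
  assumes A: "A \<in> carrier_mat n m" and rank: "vec_space.rank n A = 0" and x: "x \<in> carrier_vec m"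
  shows "orlicz_norm G ((mat_diag n f * A) *\<^sub>v x) = 0"
proof -
  have "(mat_diag n f * A) *\<^sub>v x = mat_diag n f *\<^sub>v 0\<^sub>v n"
    using assoc_mult_mat_vec[OF mat_diag_dim A x] rank_zero_mult[OF assms] by simp
  also have "\<dots> = 0\<^sub>v n"
    by (auto intro!: eq_vecI simp: mat_diag_def scalar_prod_def)
  finally show ?thesis
    using orlicz_norm_zero by simp
qed

lemma dilation_event_eq:
  fixes A :: "real mat"
  assumes A: "A \<in> carrier_mat n m" and K: "0 < K \<or> (K = 0 \<and> vec_space.rank n A = 0)"
  shows "\<exists>T :: (nat \<Rightarrow> real) set. countable T \<and> (\<forall>\<omega>.
      (\<forall>x\<in>carrier_vec m. orlicz_norm G ((mat_diag n (\<lambda>i. 1 / \<omega> i) * A) *\<^sub>v x) \<le> K * orlicz_norm G (A *\<^sub>v x)) =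
      (\<forall>y\<in>T. (\<Sum>i<n. G (y i * (1 / (\<omega> i * K)))) \<le> 1))"
  using K
proof (elim disjE conjE)
  assume K: "0 < K"
  define S where "S = {(\<lambda>i. vec_index (A *\<^sub>v x) i) | x. x \<in> carrier_vec m \<and> (\<Sum>i<n. G (vec_index (A *\<^sub>v x) i)) \<le> 1}"
  obtain T where T: "countable T"
    "\<And>c. (\<forall>y\<in>S. (\<Sum>i<n. G (y i * c i)) \<le> 1) \<longleftrightarrow> (\<forall>y\<in>T. (\<Sum>i<n. G (y i * c i)) \<le> 1)"
    using countable_ball_reduction[of S n] by blast
  show ?thesis
    unfolding mat_diag_mult_norm_le_iff[OF A K]
    by (intro exI[of _ T] conjI allI T(1), subst T(2)[symmetric]) (auto simp: S_def)
next
  assume "K = 0" and "vec_space.rank n A = 0"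
  \<comment> \<open>Both norms' sides are \<open>0\<close> here, so the inequality always holds and
    the empty \<open>T\<close> expresses it.\<close>
  then show ?thesis
    using mat_diag_mult_norm_rank_zero[OF A] by (intro exI[of _ "{}"]) simp
qed

text \<open>\<open>measure\<close> is \<open>0\<close> on nonmeasurable sets, so a lower bound by
  inclusion of a smaller event is valid only once this is known.\<close>

lemma dilation_event_measurable:
  fixes A :: "real mat"
  assumes law: "diagonal_law G n \<mu>"
    and A: "A \<in> carrier_mat n m" and K: "0 < K \<or> (K = 0 \<and> vec_space.rank n A = 0)"
  shows "{\<omega> \<in> space \<mu>. \<forall>x \<in> carrier_vec m.
      orlicz_norm G ((mat_inv (mat_diag n \<omega>) * A) *\<^sub>v x) \<le> K * orlicz_norm G (A *\<^sub>v x)} \<in> sets \<mu>"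
proof -
  define P where "P D \<longleftrightarrow> (\<forall>x\<in>carrier_vec m. orlicz_norm G ((D * A) *\<^sub>v x) \<le> K * orlicz_norm G (A *\<^sub>v x))" for D
  obtain T where T: "countable T" "\<And>\<omega>. P (mat_diag n (\<lambda>i. 1 / \<omega> i)) \<longleftrightarrow>
      (\<forall>y\<in>T. (\<Sum>i<n. G (y i * (1 / (\<omega> i * K)))) \<le> 1)"
    using dilation_event_eq[OF A K] unfolding P_def by blast
  note [measurable] = diagonal_law_measurable[OF law]
  have [measurable]: "(\<lambda>\<omega>. \<Sum>i<n. G (y i * (1 / (\<omega> i * K)))) \<in> borel_measurable \<mu>" for y
    using diagonal_law_measurable[OF law]
    by (intro borel_measurable_sum borel_measurable_divide borel_measurable_times borel_measurable_const
        measurable_compose[OF _ borel_measurable]) auto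
  \<comment> \<open>Invertible sample points get the countable conjunction; on the rest the event
    has one constant truth value, so it contains all of them or none.\<close>
  define Q where "Q \<omega> \<longleftrightarrow> (if \<forall>i<n. \<omega> i \<noteq> 0 then \<forall>y\<in>T. (\<Sum>i<n. G (y i * (1 / (\<omega> i * K)))) \<le> 1 else P (the None))" for \<omega>
  have "P (mat_inv (mat_diag n \<omega>)) \<longleftrightarrow> Q \<omega>" for \<omega>
    using T(2)[of \<omega>] mat_inv_mat_diag[of n \<omega>] mat_inv_mat_diag_singular[of _ n \<omega>]
    by (cases "\<forall>i<n. \<omega> i \<noteq> 0") (auto simp: Q_def)
  moreover have "{\<omega> \<in> space \<mu>. Q \<omega>} \<in> sets \<mu>"
  proof -
    let ?U = "{\<omega> \<in> space \<mu>. \<forall>i<n. \<omega> i \<noteq> 0}"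
      and ?V = "{\<omega> \<in> space \<mu>. \<forall>y\<in>T. (\<Sum>i<n. G (y i * (1 / (\<omega> i * K)))) \<le> 1}"
    have V: "?V \<in> sets \<mu>"
      by (rule sets.sets_Collect_countable_All'[OF _ T(1)]) measurable
    have U: "?U \<in> sets \<mu>"
      unfolding neq_iff by measurable
    have "{\<omega> \<in> space \<mu>. Q \<omega>} = (?U \<inter> ?V) \<union> (if P (the None) then space \<mu> - ?U else {})"
      unfolding Q_def by (cases "P (the None)") auto
    also have "\<dots> \<in> sets \<mu>"
      by (cases "P (the None)") (simp_all only: if_True if_False sets.Un sets.Int sets.Diff sets.top sets.empty_sets U V)
    finally show ?thesis .
  qed
  ultimately show ?thesis
    unfolding P_def by simp
qed

section \<open>Probability of the dilation bound\<close>

text \<open>A sample point that is good for the nearly Auerbach basis is good for the whole column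
  space. The constant is \<open>2 * 200 * 42\<close>: coefficient bound, Markov threshold, and the
  factor of \<open>ln n\<close>.\<close>

lemma dilation_probability:
  fixes A :: "real mat"
  assumes super: "\<And>a b. G a * G b \<le> \<alpha> * G (a * b)" and \<alpha>: "1 \<le> \<alpha>"
    and n: "2 \<le> n" and A: "A \<in> carrier_mat n m" and rank: "vec_space.rank n A = d"
    and law: "diagonal_law G n \<mu>"
  shows "99 / 100 \<le> measure \<mu> {\<omega> \<in> space \<mu>. \<forall>x \<in> carrier_vec m.
      orlicz_norm G ((mat_inv (mat_diag n \<omega>) * A) *\<^sub>v x)
        \<le> 16800 * \<alpha> * (real d)\<^sup>2 * ln (real n) * orlicz_norm G (A *\<^sub>v x)}"
    (is "_ \<le> measure \<mu> ?S")
proof -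
  interpret prob_space \<mu>
    using law by (simp add: diagonal_law_def)
  define K where "K = 16800 * \<alpha> * (real d)\<^sup>2 * ln (real n)"
  have K: "0 < K \<or> (K = 0 \<and> vec_space.rank n A = 0)"
    using n \<alpha> rank by (cases "d = 0") (auto simp: K_def)
  have S: "?S \<in> sets \<mu>"
    using dilation_event_measurable[OF law A K] unfolding K_def .
  define N where "N = {v \<in> carrier_vec n. (\<Sum>i<n. G (vec_index v i)) \<le> 1}"
  have N_bounded: "\<bar>vec_index v i\<bar> \<le> 1" if "v \<in> N" "i < n" for v i
  proof -
    have "G (vec_index v i) \<le> (\<Sum>i<n. G (vec_index v i))"
      using that by (intro member_le_sum) auto
    then show ?thesis
      using that by (simp add: N_def le_one_iff[symmetric])
  qed
  have N_absorbing: "\<exists>c>0. c \<cdot>\<^sub>v v \<in> N" if "v \<in> carrier_vec n" for v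
  proof -
    obtain \<beta> where "0 < \<beta>" "(\<Sum>i<n. G (vec_index v i / \<beta>)) \<le> 1"
      using gauge_nonempty[of v] \<open>v \<in> carrier_vec n\<close> by auto
    then show ?thesis
      using \<open>v \<in> carrier_vec n\<close> by (intro exI[of _ "1 / \<beta>"]) (simp add: N_def)
  qed
  obtain Y where Y: "\<forall>j<d. Y j \<in> N \<and> Y j \<in> (\<lambda>x. A *\<^sub>v x) ` carrier_vec m"
    and span: "\<forall>v\<in>N \<inter> (\<lambda>x. A *\<^sub>v x) ` carrier_vec m.
       \<exists>x. (\<forall>j<d. \<bar>x j\<bar> \<le> 2) \<and> (\<forall>i<n. vec_index v i = (\<Sum>j<d. x j * vec_index (Y j) i))"
    using near_auerbach_basis[OF A rank N_bounded N_absorbing] by blast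
  obtain k where k: "200 * real n \<le> 2 ^ k" "1 + 2 * real k \<le> 42 * ln (real n)"
    using dyadic_exponent_bound[OF n] by blast
  show ?thesis
  proof (cases "d = 0")
    case True
    \<comment> \<open>A single zero vector stands in for the empty basis; what matters is that all
      diagonal entries are positive on \<open>E\<close>.\<close>
    define E where "E = {\<omega> \<in> space \<mu>. (\<forall>i<n. 0 < \<omega> i) \<and>
      (\<Sum>j<(1::nat). \<Sum>i<n. G 0 / G (\<omega> i)) \<le> real 1 * (200 * (1 + 2 * real k))}"
    have "E \<subseteq> ?S"
    proof
      fix \<omega> assume \<omega>: "\<omega> \<in> E"
      then have "\<omega> i \<noteq> 0" if "i < n" for i
        using that by (auto simp: E_def)
      then have "mat_inv (mat_diag n \<omega>) = mat_diag n (\<lambda>i. 1 / \<omega> i)"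
        by (rule mat_inv_mat_diag)
      then show "\<omega> \<in> ?S"
        using \<omega> True mat_diag_mult_norm_rank_zero[OF A] rank by (simp add: E_def)
    qed
    then have "measure \<mu> E \<le> measure \<mu> ?S"
      using S by (rule finite_measure_mono)
    moreover have "99 / 100 \<le> measure \<mu> E"
      unfolding E_def using n k(1) by (intro prob_weighted_sum(2)[OF law, of 1 k "\<lambda>_ _. 0"]) auto
    ultimately show ?thesis
      by linarith
  next
    case False
    define E where "E = {\<omega> \<in> space \<mu>. (\<forall>i<n. 0 < \<omega> i) \<and>
      (\<Sum>j<d. \<Sum>i<n. G (vec_index (Y j) i) / G (\<omega> i)) \<le> real d * (200 * (1 + 2 * real k))}"
    \<comment> \<open>\<open>8400 = 200 * 42\<close>. Padding by \<open>d \<ge> 1\<close> makes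
      \<open>2 * d * (\<alpha> * c)\<close> equal to \<open>K\<close>, with its factor
      \<open>d^2\<close>.\<close>
    define c where "c = 8400 * real d * ln (real n)"
    have "1 * (200 * (1 + 2 * real k)) \<le> real d * (200 * (42 * ln (real n)))"
      using k(2) False by (intro mult_mono) auto
    then have kc: "200 * (1 + 2 * real k) \<le> c"
      by (simp add: c_def)
    then have c: "1 \<le> c"
      by simp
    have K_eq: "K = 2 * real d * (\<alpha> * c)"
      by (simp add: K_def c_def power2_eq_square)
    have K_pos: "0 < K"
      using K False rank by auto
    have "E \<subseteq> ?S"
    proof
      fix \<omega> assume \<omega>: "\<omega> \<in> E"
      then have nz: "\<omega> i \<noteq> 0" if "i < n" for i
        using that by (auto simp: E_def)
      have "(\<Sum>j<d. \<Sum>i<n. G (vec_index (Y j) i) / G (\<omega> i)) \<le> real d * (200 * (1 + 2 * real k))"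
        using \<omega> by (simp add: E_def)
      also have "\<dots> \<le> real d * c"
        using kc by (intro mult_left_mono) auto
      finally have bound: "(\<Sum>j<d. \<Sum>i<n. G (vec_index (Y j) i) / G (\<omega> i)) \<le> real d * c" .
      have "(\<Sum>i<n. G (vec_index (A *\<^sub>v x) i / (\<omega> i * K))) \<le> 1"
        if x: "x \<in> carrier_vec m" "(\<Sum>i<n. G (vec_index (A *\<^sub>v x) i)) \<le> 1" for x
      proof -
        have "A *\<^sub>v x \<in> N \<inter> (\<lambda>x. A *\<^sub>v x) ` carrier_vec m"
          using x A by (auto simp: N_def)
        then obtain u where "\<forall>j<d. \<bar>u j\<bar> \<le> 2"
          "\<forall>i<n. vec_index (A *\<^sub>v x) i = (\<Sum>j<d. u j * vec_index (Y j) i)"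
          using span by blast
        then show ?thesis
          unfolding K_eq using False nz by (intro combination_le[OF super \<alpha> c _ _ bound]) auto
      qed
      then have "\<forall>x\<in>carrier_vec m.
          orlicz_norm G ((mat_diag n (\<lambda>i. 1 / \<omega> i) * A) *\<^sub>v x) \<le> K * orlicz_norm G (A *\<^sub>v x)"
        by (subst mat_diag_mult_norm_le_iff[OF A K_pos]) simp
      then have "\<forall>x\<in>carrier_vec m.
          orlicz_norm G ((mat_inv (mat_diag n \<omega>) * A) *\<^sub>v x) \<le> K * orlicz_norm G (A *\<^sub>v x)"
        using mat_inv_mat_diag[of n \<omega>] nz by metis
      then show "\<omega> \<in> ?S"
        using \<omega> by (simp add: E_def K_def)
    qed
    then have "measure \<mu> E \<le> measure \<mu> ?S"
      using S by (rule finite_measure_mono)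
    moreover have "99 / 100 \<le> measure \<mu> E"
      unfolding E_def using False n k(1) Y by (intro prob_weighted_sum(2)[OF law]) (auto simp: N_def)
    ultimately show ?thesis
      by linarith
  qed
qed

end

text \<open>\<open>C\<close> is chosen before \<open>G\<close>, hence absolute, and
  \<open>\<alpha>\<close> before \<open>n\<close>, \<open>A\<close> and the law, hence dependent on
  \<open>G\<close> alone. The logarithm forces \<open>2 \<le> n\<close>: at \<open>n = 1\<close> the
  right-hand side would be \<open>0\<close>.\<close>

theorem theorem10:
  shows "\<exists>C>0. \<forall>G. property_P G \<longrightarrow>
    (\<exists>\<alpha>\<ge>1. \<forall>(n::nat) (m::nat) (d::nat) (A::real mat) (\<mu>::(nat \<Rightarrow> real) measure).
       2 \<le> n \<longrightarrow> A \<in> carrier_mat n m \<longrightarrow> vec_space.rank n A = d \<longrightarrow> d \<le> n \<longrightarrow>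
       diagonal_law G n \<mu> \<longrightarrow>
       measure \<mu> {\<omega> \<in> space \<mu>. \<forall>x \<in> carrier_vec m.
           orlicz_norm G ((mat_inv (mat_diag n \<omega>) * A) *\<^sub>v x)
             \<le> C * \<alpha> * (real d)\<^sup>2 * ln (real n) * orlicz_norm G (A *\<^sub>v x)} \<ge> 99 / 100)"
proof (rule exI[of _ 16800], intro conjI allI impI)
  fix G assume "property_P G"
  then interpret orlicz_function G
    by unfold_locales
  obtain \<alpha> where "1 \<le> \<alpha>" "\<And>a b. G a * G b \<le> \<alpha> * G (a * b)"
    using supermultiplicative by blast
  then show "\<exists>\<alpha>\<ge>1. \<forall>(n::nat) (m::nat) (d::nat) (A::real mat) (\<mu>::(nat \<Rightarrow> real) measure).
       2 \<le> n \<longrightarrow> A \<in> carrier_mat n m \<longrightarrow> vec_space.rank n A = d \<longrightarrow> d \<le> n \<longrightarrow>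
       diagonal_law G n \<mu> \<longrightarrow>
       measure \<mu> {\<omega> \<in> space \<mu>. \<forall>x \<in> carrier_vec m.
           orlicz_norm G ((mat_inv (mat_diag n \<omega>) * A) *\<^sub>v x)
             \<le> 16800 * \<alpha> * (real d)\<^sup>2 * ln (real n) * orlicz_norm G (A *\<^sub>v x)} \<ge> 99 / 100"
    using dilation_probability by (intro exI[of _ \<alpha>]) blast
qed simp

end
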